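(* Consider the online graph partitioning problem with $\ell$ servers, server capacity $k$, and a fixed constant $\varepsilon$ with $(10/k)^{1/4}\le \varepsilon<1/4$, where the online algorithm may place up to $(1+\varepsilon)k$ vertices on each server. There exists a deterministic online algorithm whose competitive ratio is $O(\ell\log k)$ (the constant hidden in the $O$-notation may depend on $\varepsilon$).
   Context: Online graph partitioning problem: There is a vertex set $V$ with $|V|=\ell\cdot k$. Initially each vertex is assigned to one of $\ell$ servers so that every server holds exactly $k$ vertices, and the graph $G=(V,E)$ has $E=\emptyset$. Edges of $G$ are then revealed one by one in an online fashion. The request sequence is guaranteed to be such that at all times there exists an assignment of vertices to servers in which each server holds at most $k$ vertices and every connected component of the current graph lies entirely on one server. After each edge insertion, an online algorithm must (possibly) move vertices between servers so that every connected component of the revealed graph lies entirely on a single server (cc-condition), while each server holds at most $(1+\varepsilon)k$ vertices. Each vertex move costs $1/k$. The optimal offline algorithm $\mathrm{OPT}$ knows the whole sequence in advance and must keep at most $k$ vertices per server; its cost is the minimum total cost of moves needed to satisfy the cc-condition throughout. The (strict) competitive ratio of an online algorithm $\mathrm{ONL}$ is the supremum over request sequences of $\mathrm{cost}(\mathrm{ONL})/\mathrm{cost}(\mathrm{OPT})$; for deterministic algorithms the edge insertion order is adversarial. *)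

theory Defs
  imports Complex_Main "HOL-Library.FuncSet" "HOL-Library.Extended_Nonnegative_Real"
begin

definition connected_components :: "'v set \<Rightarrow> 'v set set \<Rightarrow> 'v set set" where
  "connected_components V E =
     V // {(u, v). u \<in> V \<and> v \<in> V \<and> (u, v) \<in> {(x, y). {x, y} \<in> E}\<^sup>*}"

text \<open>An assignment maps the vertices to the servers \<open>0, \<dots>, l - 1\<close>.\<close>

definition load :: "'v set \<Rightarrow> ('v \<Rightarrow> nat) \<Rightarrow> nat \<Rightarrow> nat" where
  "load V \<sigma> s = card {v \<in> V. \<sigma> v = s}"

definition cc_condition :: "'v set \<Rightarrow> 'v set set \<Rightarrow> ('v \<Rightarrow> nat) \<Rightarrow> bool" where
  "cc_condition V E \<sigma> \<longleftrightarrow> (\<forall>K \<in> connected_components V E. \<exists>s. \<forall>v \<in> K. \<sigma> v = s)"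

definition feasible :: "'v set \<Rightarrow> nat \<Rightarrow> real \<Rightarrow> 'v set set \<Rightarrow> ('v \<Rightarrow> nat) \<Rightarrow> bool" where
  "feasible V l cap E \<sigma> \<longleftrightarrow>
     \<sigma> \<in> V \<rightarrow>\<^sub>E {..<l} \<and> (\<forall>s<l. real (load V \<sigma> s) \<le> cap) \<and> cc_condition V E \<sigma>"

definition initial_assignment :: "'v set \<Rightarrow> nat \<Rightarrow> nat \<Rightarrow> ('v \<Rightarrow> nat) \<Rightarrow> bool" where
  "initial_assignment V l k \<sigma> \<longleftrightarrow> \<sigma> \<in> V \<rightarrow>\<^sub>E {..<l} \<and> (\<forall>s<l. load V \<sigma> s = k)"

text \<open>The graph after \<open>i\<close> insertions has the edge set \<open>set (take i es)\<close>.\<close>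

definition request_sequence :: "'v set \<Rightarrow> nat \<Rightarrow> nat \<Rightarrow> 'v set list \<Rightarrow> bool" where
  "request_sequence V l k es \<longleftrightarrow>
     distinct es \<and> (\<forall>e \<in> set es. e \<subseteq> V \<and> card e = 2) \<and>
     (\<forall>i \<le> length es. \<exists>\<sigma>. feasible V l (real k) (set (take i es)) \<sigma>)"

text \<open>A schedule \<open>\<tau>\<close> gives the assignment \<open>\<tau> i\<close> in force after the \<open>i\<close>-th insertion has been
  served; \<open>\<tau> 0\<close> is the initial assignment. Only its values at \<open>0, \<dots>, length es\<close> matter.\<close>

definition schedule ::
  "'v set \<Rightarrow> nat \<Rightarrow> real \<Rightarrow> ('v \<Rightarrow> nat) \<Rightarrow> 'v set list \<Rightarrow> (nat \<Rightarrow> 'v \<Rightarrow> nat) \<Rightarrow> bool" where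
  "schedule V l cap \<sigma> es \<tau> \<longleftrightarrow>
     \<tau> 0 = \<sigma> \<and> (\<forall>i \<in> {1..length es}. feasible V l cap (set (take i es)) (\<tau> i))"

definition schedule_cost :: "'v set \<Rightarrow> nat \<Rightarrow> 'v set list \<Rightarrow> (nat \<Rightarrow> 'v \<Rightarrow> nat) \<Rightarrow> real" where
  "schedule_cost V k es \<tau> =
     (\<Sum>i<length es. real (card {v \<in> V. \<tau> (Suc i) v \<noteq> \<tau> i v}) / real k)"

text \<open>The infimum is a minimum, see \<open>opt_cost_attained\<close> below.\<close>

definition opt_cost :: "'v set \<Rightarrow> nat \<Rightarrow> nat \<Rightarrow> ('v \<Rightarrow> nat) \<Rightarrow> 'v set list \<Rightarrow> real" where
  "opt_cost V l k \<sigma> es = Inf {schedule_cost V k es \<tau> |\<tau>. schedule V l (real k) \<sigma> es \<tau>}"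

text \<open>A deterministic online algorithm determines the current assignment from the initial assignment
  and the edges revealed so far.\<close>

type_synonym 'v algorithm = "('v \<Rightarrow> nat) \<Rightarrow> 'v set list \<Rightarrow> 'v \<Rightarrow> nat"

definition run :: "'v algorithm \<Rightarrow> ('v \<Rightarrow> nat) \<Rightarrow> 'v set list \<Rightarrow> nat \<Rightarrow> 'v \<Rightarrow> nat" where
  "run A \<sigma> es i = A \<sigma> (take i es)"

definition online_algorithm :: "'v set \<Rightarrow> nat \<Rightarrow> nat \<Rightarrow> real \<Rightarrow> 'v algorithm \<Rightarrow> bool" where
  "online_algorithm V l k \<epsilon> A \<longleftrightarrow>
     (\<forall>\<sigma> es. initial_assignment V l k \<sigma> \<and> request_sequence V l k es \<longrightarrow>
        schedule V l ((1 + \<epsilon>) * real k) \<sigma> es (run A \<sigma> es))"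

text \<open>In \<^typ>\<open>ennreal\<close>, \<open>0 / 0 = 0\<close> and \<open>c / 0 = top\<close> for \<open>c > 0\<close>. So a finite ratio
  forces the algorithm to pay nothing whenever the optimum pays nothing, as the strict
  competitive ratio demands.\<close>

definition competitive_ratio :: "'v set \<Rightarrow> nat \<Rightarrow> nat \<Rightarrow> 'v algorithm \<Rightarrow> ennreal" where
  "competitive_ratio V l k A =
     (SUP (\<sigma>, es) \<in> {(\<sigma>, es). initial_assignment V l k \<sigma> \<and> request_sequence V l k es}.
        ennreal (schedule_cost V k es (run A \<sigma> es)) / ennreal (opt_cost V l k \<sigma> es))"

lemma opt_cost_attained:
  assumes "request_sequence V l k es"
  shows "\<exists>\<tau>. schedule V l (real k) \<sigma> es \<tau> \<and> opt_cost V l k \<sigma> es = schedule_cost V k es \<tau>"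
proof -
  define m where "m \<tau> = (\<Sum>i<length es. card {v \<in> V. \<tau> (Suc i) v \<noteq> \<tau> i v})"
    for \<tau> :: "nat \<Rightarrow> 'a \<Rightarrow> nat"
  have cost: "schedule_cost V k es \<tau> = real (m \<tau>) / real k" for \<tau>
    by (simp add: schedule_cost_def m_def sum_divide_distrib)
  have "\<forall>i. \<exists>\<rho>. i \<le> length es \<longrightarrow> feasible V l (real k) (set (take i es)) \<rho>"
    using assms by (auto simp: request_sequence_def)
  then obtain f where f: "\<And>i. i \<le> length es \<Longrightarrow> feasible V l (real k) (set (take i es)) (f i)"
    by metis
  have "schedule V l (real k) \<sigma> es (f(0 := \<sigma>))"
    using f by (auto simp: schedule_def)
  from exists_least_iff[THEN iffD1, of "\<lambda>n. \<exists>\<tau>. schedule V l (real k) \<sigma> es \<tau> \<and> m \<tau> = n"] this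
  obtain \<tau> where \<tau>: "schedule V l (real k) \<sigma> es \<tau>"
    and least: "\<And>\<tau>'. schedule V l (real k) \<sigma> es \<tau>' \<Longrightarrow> m \<tau> \<le> m \<tau>'"
    by (metis not_less)
  have "opt_cost V l k \<sigma> es = schedule_cost V k es \<tau>"
    unfolding opt_cost_def
    by (rule cInf_eq_minimum) (use \<tau> least in \<open>auto simp: cost intro!: divide_right_mono\<close>)
  with \<tau> show ?thesis by blast
qed

end

theory Submission imports Defs "HOL-Library.Disjoint_Sets" begin

text \<open>
  Let \<open>\<sigma>\<^sub>0\<close> be the initial assignment and count vertex moves instead of cost. Since edges are only
  inserted, the optimum is the least distance from \<open>\<sigma>\<^sub>0\<close> to an assignment \<open>Q\<close> that is perfect (at most
  \<open>k\<close> vertices per server) for the final graph. The algorithm has two phases.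

  As long as some perfect assignment is at distance at most \<open>\<epsilon> k / 8\<close> from \<open>\<sigma>\<^sub>0\<close>, a component with more
  than \<open>7/8\<close> of its vertices from one initial server lies there; otherwise, on a merge, it takes the
  location of its larger part. This keeps the distance to \<open>\<sigma>\<^sub>0\<close> within \<open>8\<close> times the optimum, so
  no server exceeds \<open>(1 + \<epsilon>) k\<close>. Moving the larger part decreases the distance to \<open>\<sigma>\<^sub>0\<close> by half
  of its size, so moves of smaller parts pay for everything. Every moved part lies inside a
  component in which \<open>Q\<close> displaces at least \<open>1/8\<close> of the vertices; these components cover at most
  \<open>8 \<cdot> OPT\<close> vertices, and each vertex is in the smaller part at most \<open>log\<^sub>2 k\<close> times.

  Afterwards \<open>OPT > \<epsilon> k / 8\<close>, so \<open>O(l k log k)\<close> moves in total are affordable. Components of size at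
  least \<open>k / p\<close>, where \<open>p \<ge> 2 / \<epsilon>\<close>, are large and have their size rounded down to a multiple of
  \<open>k / p\<^sup>2\<close>; the rounded sizes on each server sum to at most \<open>k\<close>. A merge moves the smaller part. If it
  violates the bound on the rounded sizes, compare the current assignment with a perfect one: by
  Dickson's lemma the violated server lies in a set of boundedly many servers that hold equally many
  large components of every rounded size in both assignments, and permuting the large components of
  these servers repairs the packing. A violation raises the rounded size of a large component, which
  happens \<open>O(l)\<close> times. Finally, single small components move from overfull servers to servers of
  load at most \<open>k\<close>, which is paid for by the excess load that they remove.
\<close>

section \<open>Zero-sum subfamilies and repairing a packing\<close>

text \<open>Induction on \<open>I\<close>: a subsequence that is monotone in the old coordinates
  stays so when thinned, and it is thinned to positions where the new coordinate is minimal among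
  all later positions.\<close>

lemma dickson_subseq:
  fixes f :: "nat \<Rightarrow> 'i \<Rightarrow> nat"
  assumes "finite I"
  shows "\<exists>r :: nat \<Rightarrow> nat. strict_mono r \<and> (\<forall>i\<in>I. \<forall>m n. m \<le> n \<longrightarrow> f (r m) i \<le> f (r n) i)"
  using assms
proof (induction I rule: finite_induct)
  case empty
  then show ?case using strict_mono_id by auto
next
  case (insert i I)
  then obtain r :: "nat \<Rightarrow> nat" where r: "strict_mono r"
    and mono: "\<And>j m n. j \<in> I \<Longrightarrow> m \<le> n \<Longrightarrow> f (r m) j \<le> f (r n) j" by blast
  have "\<exists>m>q. \<forall>n\<ge>m. f (r m) i \<le> f (r n) i" for q
  proof -
    obtain m where "m > q" "\<And>n. n > q \<Longrightarrow> f (r m) i \<le> f (r n) i"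
      using ex_has_least_nat[of "\<lambda>n. n > q" "Suc q" "\<lambda>n. f (r n) i"] by auto
    then show ?thesis by (intro exI[of _ m]) auto
  qed
  then obtain g where g: "\<And>q. g q > q" "\<And>q n. n \<ge> g q \<Longrightarrow> f (r (g q)) i \<le> f (r n) i"
    by metis
  \<comment> \<open>The exponent \<open>Suc n\<close> makes every value of \<open>h\<close>, also
    \<open>h 0\<close>, a value of \<open>g\<close> and hence a tail minimum.\<close>
  define h where "h n = (g ^^ Suc n) 0" for n
  have h_Suc: "h (Suc n) = g (h n)" for n by (simp add: h_def)
  have h: "strict_mono h" using g(1) by (simp add: strict_mono_Suc_iff h_Suc)
  have "f (r (h m)) i \<le> f (r (h n)) i" if "m \<le> n" for m n
  proof -
    have "h m \<le> h n" using h that by (simp add: strict_mono_less_eq)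
    then show ?thesis using g(2)[of "(g ^^ m) 0" "h n"] by (simp add: h_def)
  qed
  moreover have "f (r (h m)) j \<le> f (r (h n)) j" if "j \<in> I" "m \<le> n" for j m n
    using mono[OF that(1)] h that(2) by (simp add: strict_mono_less_eq)
  ultimately show ?case
    using r h by (intro exI[of _ "r \<circ> h"]) (auto simp: strict_mono_def)
qed

text \<open>Injections between the fibres over each label glue together, because fibres over
  distinct labels are disjoint.\<close>

lemma fibre_preserving_injection:
  assumes "finite A" "finite B"
    and "\<And>a. a \<in> A \<Longrightarrow> card {x \<in> A. f x = f a} \<le> card {y \<in> B. g y = f a}"
  shows "\<exists>h. inj_on h A \<and> h ` A \<subseteq> B \<and> (\<forall>a\<in>A. g (h a) = f a)"
proof -
  have "\<forall>t\<in>f ` A. \<exists>h. inj_on h {x \<in> A. f x = t} \<and> h ` {x \<in> A. f x = t} \<subseteq> {y \<in> B. g y = t}"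
  proof
    fix t assume "t \<in> f ` A"
    then have "card {x \<in> A. f x = t} \<le> card {y \<in> B. g y = t}" using assms(3) by auto
    then show "\<exists>h. inj_on h {x \<in> A. f x = t} \<and> h ` {x \<in> A. f x = t} \<subseteq> {y \<in> B. g y = t}"
      using card_le_inj[of "{x \<in> A. f x = t}" "{y \<in> B. g y = t}"] assms(1,2) by auto
  qed
  from bchoice[OF this] obtain h where
    h: "\<And>t. t \<in> f ` A \<Longrightarrow> inj_on (h t) {x \<in> A. f x = t}"
      "\<And>t. t \<in> f ` A \<Longrightarrow> h t ` {x \<in> A. f x = t} \<subseteq> {y \<in> B. g y = t}" by blast
  have img: "h (f a) a \<in> B \<and> g (h (f a) a) = f a" if "a \<in> A" for a
    using h(2)[of "f a"] that by auto
  have "inj_on (\<lambda>a. h (f a) a) A"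
  proof (rule inj_onI)
    fix x y assume xy: "x \<in> A" "y \<in> A" "h (f x) x = h (f y) y"
    then have "f x = f y" using img by metis
    then show "x = y" using xy h(1)[of "f x"] by (auto dest: inj_onD)
  qed
  then show ?thesis using img by (intro exI[of _ "\<lambda>a. h (f a) a"]) auto
qed

lemma fibre_preserving_bijection:
  assumes "finite A" "finite B"
    and eq: "\<And>t. card {x \<in> A. f x = t} = card {y \<in> B. g y = t}"
  shows "\<exists>h. bij_betw h A B \<and> (\<forall>a\<in>A. g (h a) = f a)"
proof -
  obtain h where h: "inj_on h A" "h ` A \<subseteq> B" "\<forall>a\<in>A. g (h a) = f a"
    using fibre_preserving_injection[of A B f g] assms by auto
  obtain h' where "inj_on h' B" "h' ` B \<subseteq> A"
    using fibre_preserving_injection[of B A g f] assms by auto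
  then have "card B \<le> card A" using assms(1) card_inj_on_le by blast
  then have "h ` A = B"
    using h assms(2) by (simp add: card_image card_seteq)
  then show ?thesis using h by (auto simp: bij_betw_def)
qed

text \<open>If no \<open>N\<close> worked, there would be a bad family for every \<open>n\<close>.
  By Dickson's lemma the type counts increase along a subsequence, so an early family embeds, type
  by type, into a later one. Its image is a zero-sum subfamily through the distinguished element
  that is too small for the later family to be bad. The bound depends only on \<open>T\<close> and
  \<open>w\<close>, not on the size of \<open>S\<close>.\<close>

lemma bounded_zero_sum_subset:
  fixes w :: "'t \<Rightarrow> 'j \<Rightarrow> int"
  assumes "finite T"
  shows "\<exists>N. \<forall>(S :: nat set) ty s0. finite S \<and> s0 \<in> S \<and> ty ` S \<subseteq> T \<and> (\<forall>j. (\<Sum>s\<in>S. w (ty s) j) = 0)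
    \<longrightarrow> (\<exists>S0\<subseteq>S. s0 \<in> S0 \<and> card S0 \<le> N \<and> (\<forall>j. (\<Sum>s\<in>S0. w (ty s) j) = 0))"
proof (rule ccontr)
  assume "\<not> ?thesis"
  then obtain S :: "nat \<Rightarrow> nat set" and ty s0 where
    S: "\<And>n. finite (S n)" "\<And>n. s0 n \<in> S n" "\<And>n. ty n ` S n \<subseteq> T"
      "\<And>n j. (\<Sum>s\<in>S n. w (ty n s) j) = 0"
    and no: "\<And>n S0. S0 \<subseteq> S n \<Longrightarrow> s0 n \<in> S0 \<Longrightarrow> card S0 \<le> n \<Longrightarrow> \<exists>j. (\<Sum>s\<in>S0. w (ty n s) j) \<noteq> 0"
    by metis
  \<comment> \<open>The second component separates the distinguished element, so that its type is preserved.\<close>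
  define lab where "lab n s = (ty n s, s = s0 n)" for n s
  obtain r :: "nat \<Rightarrow> nat" where r: "strict_mono r"
    and mono: "\<And>i m n. i \<in> T \<times> UNIV \<Longrightarrow> m \<le> n \<Longrightarrow>
      card {s \<in> S (r m). lab (r m) s = i} \<le> card {s \<in> S (r n). lab (r n) s = i}"
    using dickson_subseq[of "T \<times> (UNIV :: bool set)" "\<lambda>n i. card {s \<in> S n. lab n s = i}"] assms
    by auto
  define m where "m = r 0"
  \<comment> \<open>The later index is at least \<open>card (S m)\<close>, so a copy of all of
    \<open>S m\<close> inside \<open>S n\<close> has at most \<open>n\<close> elements.\<close>
  define n where "n = r (card (S m))"
  have "card (S m) \<le> n" using r by (simp add: n_def strict_mono_imp_increasing)
  have "card {x \<in> S m. lab m x = lab m a} \<le> card {y \<in> S n. lab n y = lab m a}" if "a \<in> S m" for a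
    using mono[of "lab m a" 0 "card (S m)"] S(3)[of m] that
    unfolding m_def n_def by (auto simp: lab_def)
  then obtain h where h: "inj_on h (S m)" "h ` S m \<subseteq> S n" "\<And>a. a \<in> S m \<Longrightarrow> lab n (h a) = lab m a"
    using fibre_preserving_injection[of "S m" "S n" "lab m" "lab n"] S(1) by auto
  have "s0 n = h (s0 m)" using h(3)[OF S(2)[of m]] by (simp add: lab_def)
  then have "s0 n \<in> h ` S m" using S(2) by simp
  moreover have "card (h ` S m) \<le> n" using \<open>card (S m) \<le> n\<close> h(1) by (simp add: card_image)
  moreover have "(\<Sum>s\<in>h ` S m. w (ty n s) j) = 0" for j
  proof -
    have "(\<Sum>s\<in>h ` S m. w (ty n s) j) = (\<Sum>s\<in>S m. w (ty n (h s)) j)"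
      using h(1) by (simp add: sum.reindex)
    also have "\<dots> = (\<Sum>s\<in>S m. w (ty m s) j)"
      using h(3) by (intro sum.cong) (auto simp: lab_def)
    finally show ?thesis using S(4) by simp
  qed
  ultimately show False using no[OF h(2)] by metis
qed

section \<open>Repairing a packing by changing few servers\<close>

lemma sum_card_fibres:
  assumes "finite L" "finite S"
  shows "(\<Sum>s\<in>S. card {i \<in> L. g i = s \<and> P i}) = card {i \<in> L. g i \<in> S \<and> P i}"
proof -
  have "card {i \<in> L. g i \<in> S \<and> P i} = card (\<Union>s\<in>S. {i \<in> L. g i = s \<and> P i})"
    by (rule arg_cong[of _ _ card]) auto
  also have "\<dots> = (\<Sum>s\<in>S. card {i \<in> L. g i = s \<and> P i})"
    using assms by (intro card_UN_disjoint) auto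
  finally show ?thesis by simp
qed

text \<open>Items \<open>L\<close> of size \<open>cl\<close> are packed by \<open>g\<close> with
  capacity \<open>q\<close>, except that \<open>s0\<close> may hold up to \<open>2 * q\<close>;
  \<open>g'\<close> is a valid reference packing. A valid packing \<open>h\<close> must be reachable
  by touching at most \<open>N\<close> servers. As a predicate this can be assumed in a locale with
  \<open>N\<close> fixed in advance.\<close>

definition repairable ::
  "nat \<Rightarrow> nat \<Rightarrow> 'i set \<Rightarrow> ('i \<Rightarrow> nat) \<Rightarrow> ('i \<Rightarrow> nat) \<Rightarrow> ('i \<Rightarrow> nat) \<Rightarrow> nat \<Rightarrow> nat \<Rightarrow> bool" where
  "repairable q N L cl g g' l s0 \<longleftrightarrow>
     finite L \<and> (\<forall>i\<in>L. 0 < cl i) \<and> g ` L \<subseteq> {..<l} \<and> g' ` L \<subseteq> {..<l}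
      \<and> s0 < l \<and> (\<forall>s<l. s \<noteq> s0 \<longrightarrow> (\<Sum>i | i \<in> L \<and> g i = s. cl i) \<le> q)
      \<and> (\<Sum>i | i \<in> L \<and> g i = s0. cl i) \<le> 2 * q \<and> (\<forall>s<l. (\<Sum>i | i \<in> L \<and> g' i = s. cl i) \<le> q)
    \<longrightarrow> (\<exists>S h. S \<subseteq> {..<l} \<and> card S \<le> N \<and> h ` L \<subseteq> {..<l} \<and> (\<forall>i\<in>L. g i \<notin> S \<longrightarrow> h i = g i)
         \<and> (\<forall>s<l. (\<Sum>i | i \<in> L \<and> h i = s. cl i) \<le> q))"

text \<open>The configuration of a server counts its items of each size; positive sizes and bounded
  totals leave finitely many configurations. Over all servers the differences between the
  configurations under \<open>g\<close> and \<open>g'\<close> cancel, so they already cancel on a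
  bounded set \<open>S\<close> containing \<open>s0\<close>. On \<open>S\<close> both packings hold
  equally many items of each size, and the servers of \<open>S\<close> can adopt the packing
  \<open>g'\<close> up to exchanging items of equal size.\<close>

lemma ex_repairable: "\<exists>N. \<forall>(L :: 'i set) cl g g' l s0. repairable q N L cl g g' l s0"
proof -
  \<comment> \<open>Configurations vanish above \<open>2 * q\<close> and are bounded by
    \<open>2 * q\<close>, which makes \<open>F\<close> finite.\<close>
  define F :: "(nat \<Rightarrow> nat) set" where "F = {c. (\<forall>x. (x \<in> {..2*q} \<longrightarrow> c x \<in> {..2*q}) \<and> (x \<notin> {..2*q} \<longrightarrow> c x = 0))}"
  have "finite F" unfolding F_def by (rule finite_set_of_finite_funs) auto
  then have "finite (F \<times> F)" by simp
  from bounded_zero_sum_subset[OF this, of "\<lambda>t j. int (fst t j) - int (snd t j)"] obtain N where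
    N: "\<forall>(S :: nat set) ty s0. finite S \<and> s0 \<in> S \<and> ty ` S \<subseteq> F \<times> F \<and>
        (\<forall>j. (\<Sum>s\<in>S. int (fst (ty s) j) - int (snd (ty s) j)) = 0) \<longrightarrow>
      (\<exists>S0\<subseteq>S. s0 \<in> S0 \<and> card S0 \<le> N \<and> (\<forall>j. (\<Sum>s\<in>S0. int (fst (ty s) j) - int (snd (ty s) j)) = 0))"
    by (rule exE)
  show ?thesis
    unfolding repairable_def
  proof (intro exI[of _ N] allI impI, elim conjE)
    fix L :: "'i set" and cl g g' and l s0 :: nat
    assume fin: "finite L" and pos: "\<forall>i\<in>L. 0 < cl i" and g: "g ` L \<subseteq> {..<l}" and g': "g' ` L \<subseteq> {..<l}"
      and s0: "s0 < l" and wt: "\<forall>s<l. s \<noteq> s0 \<longrightarrow> (\<Sum>i | i \<in> L \<and> g i = s. cl i) \<le> q"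
      and wt0: "(\<Sum>i | i \<in> L \<and> g i = s0. cl i) \<le> 2 * q"
      and wt': "\<forall>s<l. (\<Sum>i | i \<in> L \<and> g' i = s. cl i) \<le> q"
    define cfg where "cfg g s c = card {i \<in> L. g i = s \<and> cl i = c}" for g :: "'i \<Rightarrow> nat" and s c
    have cfgF: "cfg g s \<in> F" if wt: "(\<Sum>i | i \<in> L \<and> g i = s. cl i) \<le> 2 * q" for g s
    proof -
      have "cl i \<le> 2 * q" if "i \<in> L" "g i = s" for i
        using member_le_sum[of i "{i \<in> L. g i = s}" cl] that fin wt by simp
      then have "cfg g s c = 0" if "c > 2 * q" for c
        using that fin by (fastforce simp: cfg_def)
      moreover have "cfg g s c \<le> 2 * q" for c
      proof -
        have "cfg g s c \<le> card {i \<in> L. g i = s}"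
          using fin by (auto simp: cfg_def intro: card_mono)
        also have "\<dots> = (\<Sum>i | i \<in> L \<and> g i = s. 1)" by simp
        also have "\<dots> \<le> (\<Sum>i | i \<in> L \<and> g i = s. cl i)"
          using pos by (intro sum_mono) (auto simp: Suc_le_eq)
        finally show ?thesis using wt by simp
      qed
      ultimately show ?thesis by (auto simp: F_def)
    qed
    have cfg_sum: "(\<Sum>s\<in>S. cfg g s c) = card {i \<in> L. g i \<in> S \<and> cl i = c}" if "S \<subseteq> {..<l}"
      for g :: "'i \<Rightarrow> nat" and S c
      using sum_card_fibres[of L S g "\<lambda>i. cl i = c"] fin finite_subset[OF that] by (simp add: cfg_def)
    have all: "{i \<in> L. g i \<in> {..<l} \<and> cl i = c} = {i \<in> L. g' i \<in> {..<l} \<and> cl i = c}" for c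
      using g g' by auto
    have "(\<Sum>s<l. int (cfg g s j) - int (cfg g' s j)) = 0" for j
      using cfg_sum[of "{..<l}" g j] cfg_sum[of "{..<l}" g' j] all[of j]
      by (simp add: sum_subtractf flip: of_nat_sum)
    moreover have "cfg g s \<in> F \<and> cfg g' s \<in> F" if "s < l" for s
      using that wt wt0 wt' by (intro conjI cfgF) (cases "s = s0"; fastforce)+
    ultimately obtain S where S: "S \<subseteq> {..<l}" "s0 \<in> S" "card S \<le> N"
      "\<And>j. (\<Sum>s\<in>S. int (cfg g s j) - int (cfg g' s j)) = 0"
      using N[rule_format, of "{..<l}" s0 "\<lambda>s. (cfg g s, cfg g' s)"] s0 by auto
    define I where "I = {i \<in> L. g i \<in> S}"
    define I' where "I' = {i \<in> L. g' i \<in> S}"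
    have "card {i \<in> I. cl i = c} = card {i \<in> I'. cl i = c}" for c
      using S(4)[of c] cfg_sum[OF S(1), of g c] cfg_sum[OF S(1), of g' c]
      by (simp add: sum_subtractf I_def I'_def conj_assoc flip: of_nat_sum)
    then obtain \<pi> where \<pi>: "bij_betw \<pi> I I'" "\<And>i. i \<in> I \<Longrightarrow> cl (\<pi> i) = cl i"
      using fibre_preserving_bijection[of I I' cl cl] fin by (auto simp: I_def I'_def)
    \<comment> \<open>Every item on \<open>S\<close> takes the place that its partner of the same
      size has under \<open>g'\<close>.\<close>
    define h where "h i = (if i \<in> I then g' (\<pi> i) else g i)" for i
    have hS: "h i \<in> S \<longleftrightarrow> i \<in> I" if "i \<in> L" for i
      using that bij_betwE[OF \<pi>(1)] by (auto simp: h_def I_def I'_def)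
    have "(\<Sum>i | i \<in> L \<and> h i = s. cl i) \<le> q" if "s < l" for s
    proof (cases "s \<in> S")
      case True
      have "{i. i \<in> L \<and> h i = s} = {i \<in> I. g' (\<pi> i) = s}"
        using hS True by (auto simp: h_def I_def)
      then have "(\<Sum>i | i \<in> L \<and> h i = s. cl i) = (\<Sum>i | i \<in> I \<and> g' (\<pi> i) = s. cl (\<pi> i))"
        using \<pi>(2) by (auto intro!: sum.cong)
      also have "\<dots> = (\<Sum>i | i \<in> L \<and> g' i = s. cl i)"
      proof (rule sum.reindex_bij_betw)
        show "bij_betw \<pi> {i \<in> I. g' (\<pi> i) = s} {i \<in> L. g' i = s}"
          using \<pi>(1) True unfolding bij_betw_def
          by (auto simp: I'_def intro: inj_on_subset)
      qed
      finally show ?thesis using wt' that by simp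
    next
      case False
      then have "h i = s \<longleftrightarrow> g i = s" if "i \<in> L" for i
        using hS[OF that] that by (cases "i \<in> I") (auto simp: I_def h_def)
      then have "{i. i \<in> L \<and> h i = s} = {i. i \<in> L \<and> g i = s}" by blast
      then show ?thesis using wt that False S(2) by auto
    qed
    moreover have "h ` L \<subseteq> {..<l}"
      using hS S(1) g by (force simp: h_def)
    ultimately show "\<exists>S h. S \<subseteq> {..<l} \<and> card S \<le> N \<and> h ` L \<subseteq> {..<l} \<and> (\<forall>i\<in>L. g i \<notin> S \<longrightarrow> h i = g i)
         \<and> (\<forall>s<l. (\<Sum>i | i \<in> L \<and> h i = s. cl i) \<le> q)"
      using S(1,3) by (intro exI[of _ S] exI[of _ h]) (simp add: h_def I_def)
  qed
qed

lemma card_Union_laminar_le: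
  fixes F :: "'a set set"
  assumes "finite F" "\<And>K. K \<in> F \<Longrightarrow> finite K"
    and "\<And>K K'. K \<in> F \<Longrightarrow> K' \<in> F \<Longrightarrow> K \<subseteq> K' \<or> K' \<subseteq> K \<or> K \<inter> K' = {}"
    and "\<And>K. K \<in> F \<Longrightarrow> card K \<le> c * card (K \<inter> X)"
  shows "card (\<Union>F) \<le> c * card (\<Union>F \<inter> X)"
  using assms
proof (induction "card F" arbitrary: F rule: less_induct)
  case less
  show ?case
  proof (cases "\<exists>K\<in>F. \<exists>K'\<in>F. K \<noteq> K' \<and> K \<subseteq> K'")
    case True
    then obtain K K' where K: "K \<in> F" "K' \<in> F" "K \<noteq> K'" "K \<subseteq> K'" by blast
    then have "\<Union>(F - {K}) = \<Union>F" by auto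
    moreover have "card (\<Union>(F - {K})) \<le> c * card (\<Union>(F - {K}) \<inter> X)"
    proof (rule less.hyps)
      show "card (F - {K}) < card F" using K less.prems(1) by (intro card_Diff1_less)
    qed (use less.prems in auto)
    ultimately show ?thesis by simp
  next
    case False
    then have disj: "K \<inter> K' = {}" if "K \<in> F" "K' \<in> F" "K \<noteq> K'" for K K'
      using less.prems(3) that by blast
    have "card (\<Union>F) = (\<Sum>K\<in>F. card K)"
      using disj less.prems by (subst card_Union_disjoint) (auto simp: pairwise_def disjnt_def)
    also have "\<dots> \<le> (\<Sum>K\<in>F. c * card (K \<inter> X))"
      using less.prems by (intro sum_mono) auto
    also have "\<dots> = c * card (\<Union>K\<in>F. K \<inter> X)"
      unfolding sum_distrib_left[symmetric]
      using disj less.prems by (subst card_UN_disjoint) auto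
    also have "(\<Union>K\<in>F. K \<inter> X) = \<Union>F \<inter> X" by auto
    finally show ?thesis .
  qed
qed

section \<open>Merging connected components\<close>

text \<open>The relation whose quotient is \<open>connected_components\<close>, named so that facts
  about equivalence relations apply. Only the end points of a path are restricted to
  \<open>V\<close>.\<close>

definition linked :: "'v set \<Rightarrow> 'v set set \<Rightarrow> ('v \<times> 'v) set" where
  "linked V E = {(u, v). u \<in> V \<and> v \<in> V \<and> (u, v) \<in> {(x, y). {x, y} \<in> E}\<^sup>*}"

lemma connected_components_linked: "connected_components V E = V // linked V E"
  by (simp add: connected_components_def linked_def)

lemma equiv_linked: "equiv V (linked V E)"
proof (rule equivI)
  have "sym ({(x, y). {x, y} \<in> E}\<^sup>*)"
    by (rule sym_rtrancl) (auto simp: sym_def insert_commute)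
  then show "sym (linked V E)" by (auto simp: linked_def sym_def)
qed (auto simp: linked_def refl_on_def trans_def)

lemma linked_mono: "E \<subseteq> E' \<Longrightarrow> linked V E \<subseteq> linked V E'"
proof -
  assume "E \<subseteq> E'"
  then have "{(x, y). {x, y} \<in> E}\<^sup>* \<subseteq> {(x, y). {x, y} \<in> E'}\<^sup>*" by (intro rtrancl_mono) auto
  then show ?thesis by (auto simp: linked_def)
qed

lemma partition_on_components: "partition_on V (connected_components V E)"
  unfolding connected_components_linked by (rule partition_on_quotient[OF equiv_linked])

text \<open>Two components that meet are the classes of a common vertex, and classes grow with the
  edge set.\<close>

lemma components_laminar:
  assumes "E \<subseteq> E'" "K \<in> connected_components V E" "K' \<in> connected_components V E'"
  shows "K \<subseteq> K' \<or> K \<inter> K' = {}"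
proof (cases "K \<inter> K' = {}")
  case False
  then obtain z where z: "z \<in> K" "z \<in> K'" by blast
  have cls: "K = linked V E `` {z}" if "K \<in> connected_components V E" "z \<in> K" for K E
    using that equiv_linked[of V E] unfolding connected_components_linked
    by (auto elim!: quotientE dest: equiv_class_eq)
  have "K = linked V E `` {z}" "K' = linked V E' `` {z}"
    using cls assms(2,3) z by blast+
  then show ?thesis using linked_mono[OF assms(1), of V] by auto
qed simp

lemma components_empty: "connected_components V {} = (\<lambda>v. {v}) ` V"
proof -
  have "linked V {} = Id_on V" by (auto simp: linked_def)
  then show ?thesis by (auto simp: connected_components_linked quotient_def)
qed

text \<open>An undirected edge contributes two ordered pairs, so \<open>rtrancl_insert\<close> is
  applied twice; symmetry shortens paths that use the new edge repeatedly.\<close>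

lemma linked_insert:
  assumes "a \<in> V" "b \<in> V"
  shows "linked V (insert {a, b} E) = linked V E \<union> {(u, v). (u, a) \<in> linked V E \<and> (b, v) \<in> linked V E}
    \<union> {(u, v). (u, b) \<in> linked V E \<and> (a, v) \<in> linked V E}"
proof -
  define R where "R = {(x, y). {x, y} \<in> E}"
  have sym: "(x, y) \<in> R\<^sup>* \<longleftrightarrow> (y, x) \<in> R\<^sup>*" for x y
  proof -
    have "sym (R\<^sup>*)"
      by (rule sym_rtrancl) (auto simp: sym_def insert_commute R_def)
    then show ?thesis by (auto dest: symD)
  qed
  have "{(x, y). {x, y} \<in> insert {a, b} E} = insert (a, b) (insert (b, a) R)"
    by (auto simp: R_def doubleton_eq_iff)
  then have *: "linked V (insert {a, b} E) = {(u, v). u \<in> V \<and> v \<in> V \<and> (u, v) \<in> (insert (a, b) (insert (b, a) R))\<^sup>*}"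
    by (simp only: linked_def)
  have **: "linked V E = {(u, v). u \<in> V \<and> v \<in> V \<and> (u, v) \<in> R\<^sup>*}"
    by (simp only: linked_def R_def)
  show ?thesis
    unfolding * ** rtrancl_insert using assms sym
    by (auto intro: rtrancl_trans)
qed

text \<open>Either the end points were linked before, or exactly their two classes fuse. The names
  are chosen such that \<open>A\<close> is the smaller part, the one that is cheaper to
  move.\<close>

lemma components_insert:
  assumes e: "e \<subseteq> V" "card e = 2"
  shows "connected_components V (insert e E) = connected_components V E \<or>
    (\<exists>A\<in>connected_components V E. \<exists>B\<in>connected_components V E. A \<noteq> B \<and> card A \<le> card B \<and>
      connected_components V (insert e E) = insert (A \<union> B) (connected_components V E - {A, B}))"
proof -
  obtain a b where ab: "e = {a, b}" "a \<in> V" "b \<in> V"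
    using e by (auto simp: card_2_iff)
  define r where "r = linked V E"
  have eq: "equiv V r" unfolding r_def by (rule equiv_linked)
  have ins: "linked V (insert e E) = r \<union> {(u, v). (u, a) \<in> r \<and> (b, v) \<in> r} \<union> {(u, v). (u, b) \<in> r \<and> (a, v) \<in> r}"
    using linked_insert[OF ab(2,3), of E] by (simp add: ab(1) r_def)
  have sym: "(x, y) \<in> r \<Longrightarrow> (y, x) \<in> r" for x y using eq by (meson equivE symD)
  have trans: "(x, y) \<in> r \<Longrightarrow> (y, z) \<in> r \<Longrightarrow> (x, z) \<in> r" for x y z using eq by (meson equivE transD)
  show ?thesis
  proof (cases "(a, b) \<in> r")
    case True
    then have "linked V (insert e E) = r"
      unfolding ins using sym trans by blast
    then show ?thesis by (simp add: connected_components_linked r_def)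
  next
    case False
    define A where "A = r `` {a}"
    define B where "B = r `` {b}"
    have AB: "A \<in> V // r" "B \<in> V // r" using ab by (auto simp: A_def B_def quotientI)
    have mem: "a \<in> A" "b \<in> B" unfolding A_def B_def by (intro equiv_class_self[OF eq] ab)+
    have "A \<noteq> B" using False mem(2) by (auto simp: A_def)
    have img: "linked V (insert e E) `` {v} = (if v \<in> A \<union> B then A \<union> B else r `` {v})" for v
    proof (cases "v \<in> A \<union> B")
      case True
      then consider "(v, a) \<in> r" | "(v, b) \<in> r" unfolding A_def B_def using sym by blast
      then have "linked V (insert e E) `` {v} = A \<union> B"
      proof cases
        case 1
        then have "r `` {v} = A" unfolding A_def using sym trans by blast
        with 1 show ?thesis unfolding ins A_def B_def using trans by blast
      next
        case 2
        then have "r `` {v} = B" unfolding B_def using sym trans by blast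
        with 2 show ?thesis unfolding ins A_def B_def using trans by blast
      qed
      with True show ?thesis by simp
    next
      case False
      then have "(v, a) \<notin> r" "(v, b) \<notin> r" unfolding A_def B_def using sym by blast+
      with False show ?thesis unfolding ins by auto
    qed
    have in_AB: "v \<in> A \<union> B \<longleftrightarrow> r `` {v} \<in> {A, B}" if "v \<in> V" for v
      using that eq ab unfolding A_def B_def by (auto simp: eq_equiv_class_iff dest: sym)
    have "V // linked V (insert e E) = insert (A \<union> B) (V // r - {A, B})"
    proof (intro set_eqI iffI)
      fix K assume "K \<in> V // linked V (insert e E)"
      then obtain v where v: "v \<in> V" "K = linked V (insert e E) `` {v}" by (auto elim: quotientE)
      then show "K \<in> insert (A \<union> B) (V // r - {A, B})"
        using img[of v] in_AB[of v] by (auto simp: quotientI split: if_splits)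
    next
      fix K assume K: "K \<in> insert (A \<union> B) (V // r - {A, B})"
      show "K \<in> V // linked V (insert e E)"
      proof (cases "K = A \<union> B")
        case True
        then have "K = linked V (insert e E) `` {a}" using img[of a] mem by simp
        then show ?thesis using ab by (auto intro: quotientI)
      next
        case False
        then obtain v where v: "v \<in> V" "K = r `` {v}" "K \<notin> {A, B}" using K by (auto elim: quotientE)
        then have "K = linked V (insert e E) `` {v}" using img[of v] in_AB[of v] by auto
        then show ?thesis using v by (auto intro: quotientI)
      qed
    qed
    then have C: "connected_components V (insert e E) = insert (A \<union> B) (connected_components V E - {A, B})"
      by (simp only: connected_components_linked r_def)
    then have C': "connected_components V (insert e E) = insert (B \<union> A) (connected_components V E - {B, A})"
      by (simp only: Un_commute insert_commute)
    have AB': "A \<in> connected_components V E" "B \<in> connected_components V E"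
      using AB by (simp_all add: connected_components_linked r_def)
    show ?thesis
    proof (cases "card A \<le> card B")
      case True
      with C AB' \<open>A \<noteq> B\<close> show ?thesis by blast
    next
      case False
      then have "card B \<le> card A" by simp
      with C' AB' \<open>A \<noteq> B\<close> show ?thesis by blast
    qed
  qed
qed

lemma cc_condition_iff:
  "cc_condition V E \<sigma> \<longleftrightarrow> (\<forall>K\<in>connected_components V E. \<forall>u\<in>K. \<forall>v\<in>K. \<sigma> u = \<sigma> v)"
proof -
  have "(\<exists>s. \<forall>v\<in>K. \<sigma> v = s) \<longleftrightarrow> (\<forall>u\<in>K. \<forall>v\<in>K. \<sigma> u = \<sigma> v)" for K
    by (cases "K = {}") (simp, metis ex_in_conv)
  then show ?thesis by (simp add: cc_condition_def)
qed

text \<open>Components of the smaller edge set refine those of the larger one. Hence an assignment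
  that is valid for the final graph is valid throughout.\<close>

lemma cc_condition_antimono:
  assumes "E \<subseteq> E'" "cc_condition V E' \<sigma>"
  shows "cc_condition V E \<sigma>"
  unfolding cc_condition_iff
proof (intro ballI)
  fix K u v assume K: "K \<in> connected_components V E" "u \<in> K" "v \<in> K"
  have "u \<in> V" using K partition_on_components[of V E] by (auto simp: partition_on_def)
  then obtain K' where K': "K' \<in> connected_components V E'" "u \<in> K'"
    using partition_on_components[of V E'] by (auto simp: partition_on_def)
  then have "K \<subseteq> K'" using components_laminar[OF assms(1) K(1) K'(1)] K by auto
  then show "\<sigma> u = \<sigma> v" using assms(2) K K' unfolding cc_condition_iff by blast
qed

section \<open>Packed assignments\<close>

definition moves :: "'v set \<Rightarrow> ('v \<Rightarrow> nat) \<Rightarrow> ('v \<Rightarrow> nat) \<Rightarrow> nat" where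
  "moves V \<sigma> \<tau> = card {v \<in> V. \<tau> v \<noteq> \<sigma> v}"

text \<open>The cc-condition for an arbitrary family of blocks, so that merges can be studied
  without a graph.\<close>

definition blockwise :: "'v set set \<Rightarrow> ('v \<Rightarrow> nat) \<Rightarrow> bool" where
  "blockwise C \<sigma> \<longleftrightarrow> (\<forall>K\<in>C. \<forall>u\<in>K. \<forall>v\<in>K. \<sigma> u = \<sigma> v)"

definition relocate :: "'v set \<Rightarrow> nat \<Rightarrow> ('v \<Rightarrow> nat) \<Rightarrow> 'v \<Rightarrow> nat" where
  "relocate K s \<sigma> = (\<lambda>v. if v \<in> K then s else \<sigma> v)"

text \<open>Each vertex of \<open>D\<close> contributes the binary logarithm of
  \<open>k / card K\<close> for its block \<open>K\<close>, a bound on how often that block can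
  still double within size \<open>k\<close>.\<close>

definition log_potential :: "nat \<Rightarrow> 'v set \<Rightarrow> 'v set set \<Rightarrow> real" where
  "log_potential k D C = (\<Sum>K\<in>C. real (card (K \<inter> D)) * (log 2 (real k) - log 2 (real (card K))))"

text \<open>The size of a large block in units of \<open>k / p\<^sup>2\<close>, rounded down, so
  that a capacity of \<open>k\<close> becomes \<open>p\<^sup>2\<close>. Small blocks weigh
  nothing.\<close>

definition weight :: "nat \<Rightarrow> nat \<Rightarrow> 'v set \<Rightarrow> nat" where
  "weight p k K = (if k \<le> p * card K then p\<^sup>2 * card K div k else 0)"

definition server_weight :: "nat \<Rightarrow> nat \<Rightarrow> 'v set set \<Rightarrow> ('v \<Rightarrow> nat) \<Rightarrow> nat \<Rightarrow> nat" where
  "server_weight p k C \<sigma> s = (\<Sum>K\<in>C. if \<sigma> ` K = {s} then weight p k K else 0)"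

text \<open>Each vertex contributes the number of units by which the weight of its block can still
  rise. The subtraction does not truncate for blocks of size at most \<open>k\<close>, by
  \<open>weight_le\<close>.\<close>

definition weight_potential :: "nat \<Rightarrow> nat \<Rightarrow> 'v set set \<Rightarrow> nat" where
  "weight_potential p k C = (\<Sum>K\<in>C. card K * (p\<^sup>2 - weight p k K))"

lemma cc_condition_blockwise: "cc_condition V E \<sigma> \<longleftrightarrow> blockwise (connected_components V E) \<sigma>"
  unfolding cc_condition_iff blockwise_def ..

lemma blockwiseD: "blockwise C \<sigma> \<Longrightarrow> K \<in> C \<Longrightarrow> u \<in> K \<Longrightarrow> v \<in> K \<Longrightarrow> \<sigma> u = \<sigma> v"
  unfolding blockwise_def by blast

lemma blockwise_image:
  "blockwise C \<sigma> \<Longrightarrow> K \<in> C \<Longrightarrow> v \<in> K \<Longrightarrow> \<sigma> ` K = {\<sigma> v}"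
  unfolding blockwise_def by blast

lemma moves_self [simp]: "moves V \<sigma> \<sigma> = 0"
  by (simp add: moves_def)

lemma moves_triangle: "finite V \<Longrightarrow> moves V \<sigma> \<rho> \<le> moves V \<sigma> \<tau> + moves V \<tau> \<rho>"
proof -
  assume V: "finite V"
  have "card {v \<in> V. \<rho> v \<noteq> \<sigma> v} \<le> card ({v \<in> V. \<tau> v \<noteq> \<sigma> v} \<union> {v \<in> V. \<rho> v \<noteq> \<tau> v})"
    using V by (intro card_mono) auto
  also have "\<dots> \<le> card {v \<in> V. \<tau> v \<noteq> \<sigma> v} + card {v \<in> V. \<rho> v \<noteq> \<tau> v}" by (rule card_Un_le)
  finally show ?thesis by (simp add: moves_def)
qed

lemma moves_relocate_le: "finite K \<Longrightarrow> moves V \<sigma> (relocate K s \<sigma>) \<le> card K"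
  unfolding moves_def relocate_def by (rule card_mono) auto

lemma load_le_moves_into:
  assumes "finite V"
  shows "load V \<tau> s \<le> load V \<sigma> s + card {v \<in> V. \<tau> v = s \<and> \<tau> v \<noteq> \<sigma> v}"
proof -
  have "card {v \<in> V. \<tau> v = s} \<le> card ({v \<in> V. \<sigma> v = s} \<union> {v \<in> V. \<tau> v = s \<and> \<tau> v \<noteq> \<sigma> v})"
    using assms by (intro card_mono) auto
  also have "\<dots> \<le> card {v \<in> V. \<sigma> v = s} + card {v \<in> V. \<tau> v = s \<and> \<tau> v \<noteq> \<sigma> v}" by (rule card_Un_le)
  finally show ?thesis by (simp add: load_def)
qed

lemma load_le_moves:
  assumes "finite V"
  shows "load V \<tau> s \<le> load V \<sigma> s + moves V \<sigma> \<tau>"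
proof -
  have "card {v \<in> V. \<tau> v = s \<and> \<tau> v \<noteq> \<sigma> v} \<le> moves V \<sigma> \<tau>"
    unfolding moves_def using assms by (intro card_mono) auto
  then show ?thesis using load_le_moves_into[OF assms, of \<tau> s \<sigma>] by simp
qed

text \<open>The assumption \<open>repair\<close> is supplied by \<open>ex_repairable\<close>, with
  \<open>N\<close> chosen before \<open>l\<close>, \<open>k\<close> and \<open>V\<close>; thus
  \<open>N\<close> may enter the hidden constant.\<close>

locale servers =
  fixes V :: "'v set" and l k p N :: nat
  assumes finV: "finite V" and cardV: "card V = l * k" and k_pos: "0 < k" and p_pos: "0 < p"
    and repair: "\<And>(L :: 'v set set) cl g g' l s0. repairable (p\<^sup>2) N L cl g g' l s0"
begin

text \<open>Truncated subtraction: only the excess over \<open>(1 + 1 / p) k\<close> counts.\<close>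

definition overload :: "('v \<Rightarrow> nat) \<Rightarrow> nat" where
  "overload \<sigma> = (\<Sum>s<l. p * load V \<sigma> s - (p + 1) * k)"

text \<open>The capacity condition concerns only large blocks, through their weights. Loads are
  controlled separately, by moving small blocks.\<close>

definition packed :: "'v set set \<Rightarrow> ('v \<Rightarrow> nat) \<Rightarrow> bool" where
  "packed C \<sigma> \<longleftrightarrow> \<sigma> \<in> V \<rightarrow>\<^sub>E {..<l} \<and> blockwise C \<sigma> \<and> (\<forall>s<l. server_weight p k C \<sigma> s \<le> p\<^sup>2)"

definition perfect :: "'v set set \<Rightarrow> ('v \<Rightarrow> nat) \<Rightarrow> bool" where
  "perfect C \<sigma> \<longleftrightarrow> \<sigma> \<in> V \<rightarrow>\<^sub>E {..<l} \<and> blockwise C \<sigma> \<and> (\<forall>s<l. load V \<sigma> s \<le> k)"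

section \<open>Blocks, loads and the excess over the rounded capacity\<close>

lemma finite_partition: "partition_on V C \<Longrightarrow> finite C"
  using finV by (rule finite_elements)

lemma finite_block: "partition_on V C \<Longrightarrow> K \<in> C \<Longrightarrow> finite K"
  using finV by (metis Union_upper finite_subset partition_onD1)

lemma block_subset: "partition_on V C \<Longrightarrow> K \<in> C \<Longrightarrow> K \<subseteq> V"
  by (metis Union_upper partition_onD1)

lemma block_nonempty: "partition_on V C \<Longrightarrow> K \<in> C \<Longrightarrow> K \<noteq> {}"
  by (metis partition_onD3)

lemma block_disjoint: "partition_on V C \<Longrightarrow> K \<in> C \<Longrightarrow> K' \<in> C \<Longrightarrow> K \<noteq> K' \<Longrightarrow> K \<inter> K' = {}"
  by (metis partition_onD2 disjointD)

lemma card_block_pos: "partition_on V C \<Longrightarrow> K \<in> C \<Longrightarrow> 0 < card K"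
  using finite_block block_nonempty by (simp add: card_gt_0_iff)

lemma sum_load: "S \<subseteq> {..<l} \<Longrightarrow> (\<Sum>s\<in>S. load V \<sigma> s) = card {v \<in> V. \<sigma> v \<in> S}"
  using sum_card_fibres[of V S \<sigma> "\<lambda>_. True"] finV finite_subset[of S "{..<l}"] by (simp add: load_def)

lemma load_eq_sum_blocks:
  assumes C: "partition_on V C" and "blockwise C \<sigma>"
  shows "load V \<sigma> s = (\<Sum>K\<in>C. if \<sigma> ` K = {s} then card K else 0)"
proof -
  have "{v \<in> V. \<sigma> v = s} = \<Union>{K \<in> C. \<sigma> ` K = {s}}"
  proof (intro set_eqI iffI)
    fix v assume v: "v \<in> {v \<in> V. \<sigma> v = s}"
    then obtain K where "K \<in> C" "v \<in> K" using C by (auto dest: partition_onD1)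
    then show "v \<in> \<Union>{K \<in> C. \<sigma> ` K = {s}}" using v blockwise_image[OF assms(2), of K v] by blast
  qed (use C in \<open>auto dest: partition_onD1\<close>)
  then have "load V \<sigma> s = (\<Sum>K | K \<in> C \<and> \<sigma> ` K = {s}. card K)"
    unfolding load_def using finite_block[OF C] block_disjoint[OF C]
    by (simp only:) (rule card_Union_disjoint, auto simp: pairwise_def disjnt_def)
  then show ?thesis using finite_partition[OF C] by (simp add: sum.If_cases Collect_conj_eq)
qed

lemma exists_server_load_le:
  assumes "\<sigma> \<in> V \<rightarrow>\<^sub>E {..<l}" "0 < l"
  shows "\<exists>s<l. load V \<sigma> s \<le> k"
proof (rule ccontr)
  assume "\<not> ?thesis"
  then have "(\<Sum>s<l. k) < (\<Sum>s<l. load V \<sigma> s)"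
    using assms(2) by (intro sum_strict_mono) auto
  moreover have "{v \<in> V. \<sigma> v \<in> {..<l}} = V" using assms(1) by auto
  ultimately show False using sum_load[of "{..<l}" \<sigma>] cardV by simp
qed

text \<open>Only vertices that enter a server raise its load, and each moved vertex enters one
  server, where it adds at most \<open>p\<close> to the excess.\<close>

lemma overload_le_moves: "overload \<tau> \<le> overload \<sigma> + p * moves V \<sigma> \<tau>"
proof -
  define m where "m s = card {v \<in> V. \<tau> v = s \<and> \<tau> v \<noteq> \<sigma> v}" for s
  have "p * load V \<tau> s - (p + 1) * k \<le> (p * load V \<sigma> s - (p + 1) * k) + p * m s" for s
  proof -
    have "p * load V \<tau> s \<le> p * (load V \<sigma> s + m s)"
      using load_le_moves_into[OF finV, of \<tau> s \<sigma>] by (intro mult_left_mono) (auto simp: m_def)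
    then show ?thesis by (simp add: algebra_simps)
  qed
  then have "overload \<tau> \<le> (\<Sum>s<l. (p * load V \<sigma> s - (p + 1) * k) + p * m s)"
    unfolding overload_def by (intro sum_mono)
  also have "\<dots> = overload \<sigma> + p * (\<Sum>s<l. m s)"
    by (simp add: overload_def sum.distrib sum_distrib_left)
  also have "(\<Sum>s<l. m s) \<le> moves V \<sigma> \<tau>"
    using sum_card_fibres[of V "{..<l}" \<tau> "\<lambda>v. \<tau> v \<noteq> \<sigma> v"] finV
    by (simp add: m_def moves_def card_mono Collect_mono)
  finally show ?thesis by simp
qed

text \<open>Rounding loses less than \<open>k / p\<^sup>2\<close> per large block. A large block
  weighs at least \<open>p\<close>, so a server holds at most \<open>p\<close> of them and the total
  loss is at most \<open>k / p\<close>.\<close>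

lemma large_load_le:
  assumes C: "partition_on V C" and pk: "packed C \<sigma>" and s: "s < l"
  shows "p * (\<Sum>K | K \<in> C \<and> \<sigma> ` K = {s} \<and> k \<le> p * card K. card K) \<le> (p + 1) * k"
proof -
  define S where "S = {K \<in> C. \<sigma> ` K = {s} \<and> k \<le> p * card K}"
  have fin: "finite S" using finite_partition[OF C] by (simp add: S_def)
  have wge: "p \<le> weight p k K" if "K \<in> S" for K
  proof -
    have "p * k \<le> p * (p * card K)" using that by (simp add: S_def)
    then have "p \<le> p\<^sup>2 * card K div k"
      using k_pos by (simp add: less_eq_div_iff_mult_less_eq power2_eq_square mult.assoc)
    then show ?thesis using that by (simp add: weight_def S_def)
  qed
  have cle: "p\<^sup>2 * card K \<le> (weight p k K + 1) * k" if "K \<in> S" for K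
    using that k_pos dividend_less_div_times[of k "p\<^sup>2 * card K"]
    by (simp add: weight_def S_def)
  have "(\<Sum>K\<in>S. weight p k K) = (\<Sum>K\<in>S. if \<sigma> ` K = {s} then weight p k K else 0)"
    by (intro sum.cong) (auto simp: S_def)
  also have "\<dots> \<le> server_weight p k C \<sigma> s"
    unfolding server_weight_def using finite_partition[OF C] by (intro sum_mono2) (auto simp: S_def)
  also have "\<dots> \<le> p\<^sup>2" using pk s by (simp add: packed_def)
  finally have w: "(\<Sum>K\<in>S. weight p k K) \<le> p\<^sup>2" .
  have "card S * p \<le> (\<Sum>K\<in>S. weight p k K)"
    using sum_mono[of S "\<lambda>_. p" "weight p k"] wge by simp
  then have "card S * p \<le> p * p" using w unfolding power2_eq_square by (rule le_trans)
  then have cS: "card S \<le> p" using p_pos by simp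
  have "p * (p * (\<Sum>K\<in>S. card K)) = (\<Sum>K\<in>S. p\<^sup>2 * card K)"
    by (simp add: sum_distrib_left power2_eq_square mult.assoc)
  also have "\<dots> \<le> (\<Sum>K\<in>S. (weight p k K + 1) * k)" using cle by (intro sum_mono)
  also have "\<dots> = ((\<Sum>K\<in>S. weight p k K) + card S) * k"
    by (simp add: sum_distrib_left sum.distrib algebra_simps)
  also have "\<dots> \<le> (p\<^sup>2 + p) * k" using w cS by (intro mult_right_mono add_mono) auto
  also have "\<dots> = p * ((p + 1) * k)" by (simp add: power2_eq_square algebra_simps)
  finally show ?thesis using p_pos by (simp add: S_def)
qed

text \<open>By \<open>large_load_le\<close> the large blocks alone cannot produce a load above
  \<open>(1 + 2 / p) * k\<close>.\<close>

lemma ex_small_block: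
  assumes C: "partition_on V C" and pk: "packed C \<sigma>" and s: "s < l" and ov: "(p + 2) * k < p * load V \<sigma> s"
  shows "\<exists>K\<in>C. \<sigma> ` K = {s} \<and> p * card K < k"
proof (rule ccontr)
  assume no: "\<not> ?thesis"
  have "load V \<sigma> s = (\<Sum>K | K \<in> C \<and> \<sigma> ` K = {s}. card K)"
    using load_eq_sum_blocks[OF C, of \<sigma> s] pk finite_partition[OF C]
    by (simp add: sum.If_cases Collect_conj_eq packed_def)
  also have "{K. K \<in> C \<and> \<sigma> ` K = {s}} = {K. K \<in> C \<and> \<sigma> ` K = {s} \<and> k \<le> p * card K}"
    using no by (auto simp: not_less)
  finally have "p * load V \<sigma> s \<le> (p + 1) * k"
    using large_load_le[OF C pk s] by simp
  then show False using ov by simp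
qed

section \<open>Evicting small blocks from overfull servers\<close>

lemma server_weight_cong:
  assumes "\<And>K. K \<in> C \<Longrightarrow> weight p k K \<noteq> 0 \<Longrightarrow> \<tau> ` K = \<sigma> ` K"
  shows "server_weight p k C \<tau> s = server_weight p k C \<sigma> s"
  unfolding server_weight_def by (rule sum.cong) (use assms in auto)

text \<open>A block smaller than \<open>k / p\<close> moves to a server of load at most
  \<open>k\<close>, which exists by averaging. The target then stays within
  \<open>(1 + 1 / p) * k\<close> and has no excess, while the source loses excess for every vertex.
  The weights do not change because the block is small.\<close>

lemma evict_block:
  assumes C: "partition_on V C" and pk: "packed C \<sigma>" and s: "s < l" and ov: "(p + 2) * k < p * load V \<sigma> s"
  shows "\<exists>\<tau>. packed C \<tau> \<and> 0 < moves V \<sigma> \<tau> \<and> p * moves V \<sigma> \<tau> + overload \<tau> = overload \<sigma>"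
proof -
  obtain K where K: "K \<in> C" "\<sigma> ` K = {s}" "p * card K < k"
    using ex_small_block[OF assms] by blast
  obtain t where t: "t < l" "load V \<sigma> t \<le> k"
    using exists_server_load_le[of \<sigma>] pk s by (auto simp: packed_def)
  define \<tau> where "\<tau> = relocate K t \<sigma>"
  have KV: "K \<subseteq> V" "finite K" "0 < card K"
    using K C block_subset finite_block card_block_pos by auto
  have "p * load V \<sigma> t \<le> p * k" using t(2) by simp
  moreover have "p * k \<le> (p + 2) * k" by simp
  ultimately have "s \<noteq> t" using ov by (metis le_trans not_le)
  have \<sigma>K: "\<sigma> v = s" if "v \<in> K" for v using K(2) that by auto
  have other: "\<tau> ` K' = \<sigma> ` K'" if "K' \<in> C" "K' \<noteq> K" for K'
    unfolding \<tau>_def relocate_def using block_disjoint[OF C that(1) K(1) that(2)]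
    by (intro image_cong) auto
  have "packed C \<tau>"
    unfolding packed_def
  proof (intro conjI allI impI)
    show "\<tau> \<in> V \<rightarrow>\<^sub>E {..<l}"
      using pk t(1) KV(1) by (auto simp: \<tau>_def relocate_def packed_def PiE_iff extensional_def)
    show "blockwise C \<tau>" unfolding blockwise_def
    proof (intro ballI)
      fix K' u v assume "K' \<in> C" "u \<in> K'" "v \<in> K'"
      then show "\<tau> u = \<tau> v"
        using block_disjoint[OF C _ K(1), of K'] pk unfolding packed_def blockwise_def \<tau>_def relocate_def
        by (cases "K' = K") (simp, metis disjoint_iff)
    qed
    fix s assume "s < l"
    have "server_weight p k C \<tau> s = server_weight p k C \<sigma> s"
      using K(3) by (intro server_weight_cong other) (auto simp: weight_def)
    then show "server_weight p k C \<tau> s \<le> p\<^sup>2" using pk \<open>s < l\<close> by (simp add: packed_def)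
  qed
  moreover have "{v \<in> V. \<tau> v \<noteq> \<sigma> v} = K"
    using KV(1) \<sigma>K \<open>s \<noteq> t\<close> by (auto simp: \<tau>_def relocate_def)
  then have mv: "moves V \<sigma> \<tau> = card K" by (simp add: moves_def)
  have "{v \<in> V. \<sigma> v = s} = {v \<in> V. \<tau> v = s} \<union> K" "{v \<in> V. \<tau> v = s} \<inter> K = {}"
    using KV(1) \<sigma>K \<open>s \<noteq> t\<close> by (auto simp: \<tau>_def relocate_def)
  then have ls: "load V \<sigma> s = load V \<tau> s + card K"
    using finV KV by (simp add: load_def card_Un_disjoint)
  have "{v \<in> V. \<tau> v = t} = {v \<in> V. \<sigma> v = t} \<union> K" "{v \<in> V. \<sigma> v = t} \<inter> K = {}"
    using KV(1) \<sigma>K \<open>s \<noteq> t\<close> by (auto simp: \<tau>_def relocate_def)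
  then have lt: "load V \<tau> t = load V \<sigma> t + card K"
    using finV KV by (simp add: load_def card_Un_disjoint)
  have lo: "load V \<tau> r = load V \<sigma> r" if "r \<noteq> s" "r \<noteq> t" for r
    unfolding load_def using \<sigma>K that by (intro arg_cong[of _ _ card]) (auto simp: \<tau>_def relocate_def)
  define ex where "ex \<rho> r = p * load V \<rho> r - (p + 1) * k" for \<rho> r
  have split: "overload \<rho> = ex \<rho> s + (ex \<rho> t + (\<Sum>r\<in>{..<l} - {s} - {t}. ex \<rho> r))" for \<rho>
    using s t(1) \<open>s \<noteq> t\<close> unfolding overload_def ex_def
    by (simp add: sum.remove[of "{..<l}" s] sum.remove[of "{..<l} - {s}" t])
  have "(\<Sum>r\<in>{..<l} - {s} - {t}. ex \<tau> r) = (\<Sum>r\<in>{..<l} - {s} - {t}. ex \<sigma> r)"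
    by (rule sum.cong) (auto simp: ex_def lo)
  moreover have "ex \<tau> t = 0" "ex \<sigma> t = 0"
    using \<open>p * load V \<sigma> t \<le> p * k\<close> K(3) unfolding ex_def lt
    by (simp_all only: distrib_left distrib_right)
  \<comment> \<open>Even without \<open>K\<close> the load of \<open>s\<close> exceeds
    \<open>(1 + 1 / p) * k\<close>, so the truncated difference falls by the full
    \<open>p * card K\<close>.\<close>
  moreover have "ex \<sigma> s = ex \<tau> s + p * card K"
    using ov K(3) by (auto simp: ex_def ls algebra_simps)
  ultimately show ?thesis
    using mv KV(3) \<open>packed C \<tau>\<close> by (intro exI[of _ \<tau>]) (simp add: split)
qed

text \<open>Evictions are repeated while a server is overfull. Each one strictly decreases
  \<open>overload\<close>, which ensures termination and pays for the moves.\<close>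

lemma rebalance:
  assumes C: "partition_on V C" and "packed C \<sigma>"
  shows "\<exists>\<tau>. packed C \<tau> \<and> (\<forall>s<l. p * load V \<tau> s \<le> (p + 2) * k)
    \<and> p * moves V \<sigma> \<tau> + overload \<tau> \<le> overload \<sigma>"
  using assms(2)
proof (induction "overload \<sigma>" arbitrary: \<sigma> rule: less_induct)
  case less
  show ?case
  proof (cases "\<forall>s<l. p * load V \<sigma> s \<le> (p + 2) * k")
    case True
    then show ?thesis using less.prems by (intro exI[of _ \<sigma>]) simp
  next
    case False
    then obtain s where "s < l" "(p + 2) * k < p * load V \<sigma> s" by (auto simp: not_le)
    from evict_block[OF C less.prems this] obtain \<rho> where
      \<rho>: "packed C \<rho>" "0 < moves V \<sigma> \<rho>" "p * moves V \<sigma> \<rho> + overload \<rho> = overload \<sigma>" by blast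
    then have "overload \<rho> < overload \<sigma>" using p_pos by (metis less_add_same_cancel2 nat_0_less_mult_iff)
    from less.hyps[OF this \<rho>(1)] obtain \<tau> where
      \<tau>: "packed C \<tau>" "\<forall>s<l. p * load V \<tau> s \<le> (p + 2) * k" "p * moves V \<rho> \<tau> + overload \<tau> \<le> overload \<rho>"
      by blast
    have "p * moves V \<sigma> \<tau> \<le> p * moves V \<sigma> \<rho> + p * moves V \<rho> \<tau>"
      using moves_triangle[OF finV, of \<sigma> \<tau> \<rho>] by (metis add_mult_distrib2 mult_le_mono2)
    then show ?thesis using \<tau> \<rho>(3) by (intro exI[of _ \<tau>]) auto
  qed
qed

end

section \<open>Repacking after a merge\<close>

context servers
begin

text \<open>This is the form of \<open>repairable\<close>: only blocks of positive weight are items,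
  and an arbitrary representative determines the server of a block.\<close>

lemma server_weight_eq_sum_positive:
  assumes C: "partition_on V C" and "blockwise C \<sigma>"
  shows "server_weight p k C \<sigma> s =
    (\<Sum>K | K \<in> {K \<in> C. 0 < weight p k K} \<and> \<sigma> (SOME v. v \<in> K) = s. weight p k K)"
proof -
  have "\<sigma> ` K = {s} \<longleftrightarrow> \<sigma> (SOME v. v \<in> K) = s" if "K \<in> C" for K
    using blockwise_image[OF assms(2) that, of "SOME v. v \<in> K"] block_nonempty[OF C that]
    by (simp add: some_in_eq)
  then have "server_weight p k C \<sigma> s = (\<Sum>K\<in>C. if \<sigma> (SOME v. v \<in> K) = s then weight p k K else 0)"
    unfolding server_weight_def by (intro sum.cong) auto
  also have "\<dots> = (\<Sum>K | K \<in> C \<and> \<sigma> (SOME v. v \<in> K) = s. weight p k K)"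
    using finite_partition[OF C] by (simp add: sum.If_cases Collect_conj_eq)
  also have "\<dots> = (\<Sum>K | K \<in> {K \<in> C. 0 < weight p k K} \<and> \<sigma> (SOME v. v \<in> K) = s. weight p k K)"
    using finite_partition[OF C] by (intro sum.mono_neutral_right) auto
  finally show ?thesis .
qed

text \<open>Weights are rounded down, so a load of at most \<open>k\<close> gives a total weight of
  at most \<open>p\<^sup>2\<close>.\<close>

lemma perfect_imp_packed:
  assumes C: "partition_on V C" and "perfect C \<sigma>"
  shows "packed C \<sigma>"
  unfolding packed_def
proof (intro conjI allI impI)
  show "\<sigma> \<in> V \<rightarrow>\<^sub>E {..<l}" "blockwise C \<sigma>" using assms(2) by (auto simp: perfect_def)
  fix s assume "s < l"
  have "server_weight p k C \<sigma> s * k \<le> (\<Sum>K\<in>C. p\<^sup>2 * (if \<sigma> ` K = {s} then card K else 0))"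
    unfolding server_weight_def sum_distrib_right
    by (intro sum_mono) (auto simp: weight_def)
  also have "\<dots> = p\<^sup>2 * load V \<sigma> s"
    using load_eq_sum_blocks[OF C, of \<sigma> s] assms(2) by (simp add: perfect_def sum_distrib_left)
  also have "\<dots> \<le> p\<^sup>2 * k"
    using assms(2) \<open>s < l\<close> by (simp add: perfect_def)
  finally show "server_weight p k C \<sigma> s \<le> p\<^sup>2" using k_pos by simp
qed

lemma card_block_le:
  assumes C: "partition_on V C" and "perfect C \<sigma>" and K: "K \<in> C"
  shows "card K \<le> k"
proof -
  obtain v where v: "v \<in> K" using block_nonempty[OF C K] by blast
  have "K \<subseteq> {u \<in> V. \<sigma> u = \<sigma> v}"
    using assms v block_subset[OF C K] unfolding perfect_def blockwise_def by blast
  then have "card K \<le> load V \<sigma> (\<sigma> v)" unfolding load_def using finV by (intro card_mono) auto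
  also have "\<dots> \<le> k"
    using assms(2) v block_subset[OF C K] by (auto simp: perfect_def)
  finally show ?thesis .
qed

lemma weight_le: "card K \<le> k \<Longrightarrow> weight p k K \<le> p\<^sup>2"
proof -
  assume "card K \<le> k"
  then have "p\<^sup>2 * card K div k \<le> p\<^sup>2 * k div k" by (intro div_le_mono mult_le_mono2)
  then show ?thesis using k_pos by (simp add: weight_def)
qed

lemma weight_mono: "card K \<le> card K' \<Longrightarrow> weight p k K \<le> weight p k K'"
proof -
  assume "card K \<le> card K'"
  then have "p\<^sup>2 * card K div k \<le> p\<^sup>2 * card K' div k" "p * card K \<le> p * card K'"
    by (auto intro!: div_le_mono mult_le_mono2)
  then show ?thesis by (auto simp only: weight_def split: if_splits)
qed

text \<open>The perfect assignment confines block sizes to the range from \<open>1\<close> to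
  \<open>k\<close>, so the logarithmic factor lies between \<open>0\<close> and
  \<open>log 2 k\<close>.\<close>

lemma log_potential_bounds:
  assumes C: "partition_on V C" and "perfect C P" and "D \<subseteq> V"
  shows "0 \<le> log_potential k D C" "log_potential k D C \<le> real (card D) * log 2 (real k)"
proof -
  have b: "1 \<le> card K" "card K \<le> k" if "K \<in> C" for K
    using that card_block_pos[OF C] card_block_le[OF C assms(2)] by (auto simp: Suc_le_eq)
  then have "0 \<le> log 2 (real k) - log 2 (real (card K))" if "K \<in> C" for K
    using that by force
  then show "0 \<le> log_potential k D C"
    unfolding log_potential_def by (intro sum_nonneg mult_nonneg_nonneg) auto
  have "log_potential k D C \<le> (\<Sum>K\<in>C. real (card (K \<inter> D)) * log 2 (real k))"
    unfolding log_potential_def using b by (intro sum_mono mult_left_mono) force+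
  also have "\<dots> = real (\<Sum>K\<in>C. card (K \<inter> D)) * log 2 (real k)"
    by (simp add: sum_distrib_right)
  also have "(\<Sum>K\<in>C. card (K \<inter> D)) = card (\<Union>K\<in>C. K \<inter> D)"
    using finite_partition[OF C] finite_block[OF C] block_disjoint[OF C]
    by (intro card_UN_disjoint[symmetric]) auto
  also have "(\<Union>K\<in>C. K \<inter> D) = D"
    using assms(3) partition_onD1[OF C] by auto
  finally show "log_potential k D C \<le> real (card D) * log 2 (real k)" .
qed

lemma weight_potential_le:
  assumes C: "partition_on V C"
  shows "weight_potential p k C \<le> p\<^sup>2 * card V"
proof -
  have "weight_potential p k C \<le> (\<Sum>K\<in>C. card K * p\<^sup>2)"
    unfolding weight_potential_def by (intro sum_mono mult_le_mono2) simp
  also have "\<dots> = (\<Sum>K\<in>C. card K) * p\<^sup>2" by (simp add: sum_distrib_right)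
  also have "(\<Sum>K\<in>C. card K) = card V"
    using partition_onD1[OF C] finite_block[OF C] block_disjoint[OF C]
    by (subst card_Union_disjoint[symmetric]) (auto simp: pairwise_def disjnt_def)
  finally show ?thesis by (simp add: mult.commute)
qed

end

text \<open>One insertion that fuses \<open>A\<close> into the block of \<open>B\<close>. The
  assignment \<open>P\<close> witnesses that the requests can still be served; it bounds block sizes
  by \<open>k\<close> and is the reference packing for repairs.\<close>

locale merge = servers V l k p N for V :: "'v set" and l k p N +
  fixes C :: "'v set set" and A B :: "'v set" and P :: "'v \<Rightarrow> nat"
  assumes C: "partition_on V C" and AC: "A \<in> C" and BC: "B \<in> C" and AB: "A \<noteq> B"
    and AleB: "card A \<le> card B"
    and P: "perfect (insert (A \<union> B) (C - {A, B})) P"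
begin

abbreviation "C' \<equiv> insert (A \<union> B) (C - {A, B})"

lemma disj: "A \<inter> B = {}" using block_disjoint[OF C AC BC AB] .

lemma finite_AB: "finite A" "finite B"
  using finite_block[OF C] AC BC by auto

lemma card_AB: "card (A \<union> B) = card A + card B"
  using finite_AB disj by (simp add: card_Un_disjoint)

lemma disj_rest: "K \<in> C - {A, B} \<Longrightarrow> K \<inter> (A \<union> B) = {}"
  using block_disjoint[OF C _ AC, of K] block_disjoint[OF C _ BC, of K] by auto

lemma new_block: "A \<union> B \<notin> C - {A, B}"
proof
  assume "A \<union> B \<in> C - {A, B}"
  then have "(A \<union> B) \<inter> (A \<union> B) = {}" by (rule disj_rest)
  then show False using block_nonempty[OF C AC] by auto
qed

lemma C': "partition_on V C'"
proof (rule partition_onI)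
  show "\<Union>C' = V"
    using partition_onD1[OF C] AC BC by blast
  show "disjnt K K'" if "K \<in> C'" "K' \<in> C'" "K \<noteq> K'" for K K'
    using that disj_rest block_disjoint[OF C, of K K'] unfolding disjnt_def by blast
  show "{} \<notin> C'"
    using block_nonempty[OF C] AC by auto
qed

lemma sum_C: fixes f :: "_ \<Rightarrow> 'a :: comm_monoid_add"
  shows "sum f C = f A + (f B + sum f (C - {A, B}))"
proof -
  have "C - {A} - {B} = C - {A, B}" by auto
  then show ?thesis
    using finite_partition[OF C] AC BC AB
    by (simp add: sum.remove[of C A] sum.remove[of "C - {A}" B])
qed

lemma sum_C': fixes f :: "_ \<Rightarrow> 'a :: comm_monoid_add"
  shows "sum f C' = f (A \<union> B) + sum f (C - {A, B})"
  using finite_partition[OF C] new_block by simp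

text \<open>The size of the block around a vertex of \<open>X\<close> at least doubles if
  \<open>X\<close> is at most half of the union, so each vertex of \<open>X\<close> in
  \<open>D\<close> loses at least one unit.\<close>

lemma log_potential_merge:
  "log_potential k D C' + (\<Sum>X\<in>{A, B}. if 2 * card X \<le> card (A \<union> B) \<and> X \<subseteq> D then real (card X) else 0)
    \<le> log_potential k D C"
proof -
  define f where "f X = real (card (X \<inter> D)) * (log 2 (real (card (A \<union> B))) - log 2 (real (card X)))" for X
  have f: "(if 2 * card X \<le> card (A \<union> B) \<and> X \<subseteq> D then real (card X) else 0) \<le> f X" if X: "X \<in> {A, B}" for X
  proof -
    have pos: "0 < card X" using X AC BC card_block_pos[OF C] by auto
    have "log 2 (real (card X)) \<le> log 2 (real (card (A \<union> B)))"
      using pos X card_AB by auto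
    then have "0 \<le> f X" by (simp add: f_def)
    moreover have "real (card X) \<le> f X" if "2 * card X \<le> card (A \<union> B)" "X \<subseteq> D"
    proof -
      have "1 + log 2 (real (card X)) = log 2 (2 * real (card X))"
        using pos by (simp add: log_mult)
      also have "\<dots> \<le> log 2 (real (card (A \<union> B)))"
        using pos that(1) by simp
      finally have "real (card X) * 1 \<le> real (card X) * (log 2 (real (card (A \<union> B))) - log 2 (real (card X)))"
        by (intro mult_left_mono) auto
      moreover have "X \<inter> D = X" using that(2) by auto
      ultimately show ?thesis by (simp add: f_def)
    qed
    ultimately show ?thesis by auto
  qed
  have "card ((A \<union> B) \<inter> D) = card (A \<inter> D) + card (B \<inter> D)"
    using disj finite_AB by (subst card_Un_disjoint[symmetric]) (auto simp: Int_Un_distrib2)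
  then have "log_potential k D C = log_potential k D C' + f A + f B"
    unfolding log_potential_def sum_C sum_C' by (simp add: f_def algebra_simps)
  then show ?thesis using f[of A] f[of B] AB by simp
qed

text \<open>If the union outweighs \<open>B\<close>, it also outweighs the smaller \<open>A\<close>,
  so every vertex of the union loses at least one unit.\<close>

lemma weight_potential_merge:
  "weight_potential p k C' + (if weight p k B < weight p k (A \<union> B) then card (A \<union> B) else 0)
    \<le> weight_potential p k C"
proof -
  define d where "d = (if weight p k B < weight p k (A \<union> B) then 1 else 0 :: nat)"
  have le: "weight p k (A \<union> B) \<le> p\<^sup>2"
    by (rule weight_le, rule card_block_le[OF C' P]) simp
  have "weight p k A \<le> weight p k B" "weight p k B \<le> weight p k (A \<union> B)"
    using AleB card_AB by (auto intro: weight_mono)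
  then have "p\<^sup>2 - weight p k (A \<union> B) + d \<le> p\<^sup>2 - weight p k B" "p\<^sup>2 - weight p k (A \<union> B) + d \<le> p\<^sup>2 - weight p k A"
    using le by (auto simp: d_def)
  then have "card A * (p\<^sup>2 - weight p k (A \<union> B) + d) + card B * (p\<^sup>2 - weight p k (A \<union> B) + d)
    \<le> card A * (p\<^sup>2 - weight p k A) + card B * (p\<^sup>2 - weight p k B)"
    by (intro add_mono mult_le_mono2)
  moreover have "card (A \<union> B) * d = (if weight p k B < weight p k (A \<union> B) then card (A \<union> B) else 0)"
    by (simp add: d_def)
  ultimately show ?thesis
    unfolding weight_potential_def sum_C sum_C' card_AB by (simp add: algebra_simps)
qed

text \<open>Moving \<open>A\<close> to \<open>B\<close> keeps the packing valid if the union weighs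
  no more than \<open>B\<close>. Otherwise only the server of \<open>B\<close> can be too heavy, and
  the repair with reference \<open>P\<close> changes at most \<open>N\<close> servers, each of load
  at most \<open>4 * k\<close>.\<close>

lemma packed_merge_step:
  assumes pk: "packed C \<sigma>" and ld: "\<forall>s<l. p * load V \<sigma> s \<le> (p + 2) * k"
  shows "\<exists>\<tau>. packed C' \<tau> \<and>
    moves V \<sigma> \<tau> \<le> card A + (if weight p k B < weight p k (A \<union> B) then 4 * N * k else 0)"
proof -
  obtain b0 where b0: "b0 \<in> B" using block_nonempty[OF C BC] by blast
  define b where "b = \<sigma> b0"
  define \<rho> where "\<rho> = relocate A b \<sigma>"
  have \<sigma>: "\<sigma> \<in> V \<rightarrow>\<^sub>E {..<l}" "blockwise C \<sigma>" using pk by (auto simp: packed_def)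
  have sub: "A \<subseteq> V" "B \<subseteq> V" using block_subset[OF C] AC BC by auto
  have bl: "b < l" using b0 sub \<sigma>(1) by (auto simp: b_def)
  have \<rho>AB: "\<rho> v = b" if "v \<in> A \<union> B" for v
  proof (cases "v \<in> A")
    case False
    then have "\<sigma> v = \<sigma> b0" using that \<sigma>(2) BC b0 unfolding blockwise_def by blast
    with False show ?thesis by (simp add: \<rho>_def relocate_def b_def)
  qed (simp add: \<rho>_def relocate_def)
  have \<rho>rest: "\<rho> v = \<sigma> v" if "v \<notin> A" for v
    using that by (simp add: \<rho>_def relocate_def)
  have \<rho>: "\<rho> \<in> V \<rightarrow>\<^sub>E {..<l}"
    using \<sigma>(1) bl sub by (auto simp: \<rho>_def relocate_def PiE_iff extensional_def)
  have \<rho>K: "\<rho> ` K = \<sigma> ` K" if "K \<in> C - {A, B}" for K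
    using disj_rest[OF that] \<rho>rest by (intro image_cong) auto
  have bw: "blockwise C' \<rho>"
    unfolding blockwise_def
  proof (intro ballI)
    fix K u v assume K: "K \<in> C'" "u \<in> K" "v \<in> K"
    show "\<rho> u = \<rho> v"
    proof (cases "K = A \<union> B")
      case True
      then show ?thesis using K \<rho>AB by simp
    next
      case False
      then have "K \<in> C - {A, B}" using K by simp
      moreover from disj_rest[OF this] have "\<rho> u = \<sigma> u" "\<rho> v = \<sigma> v" using K \<rho>rest by auto
      ultimately show ?thesis using blockwiseD[OF \<sigma>(2) _ K(2,3)] by simp
    qed
  qed
  have mv: "moves V \<sigma> \<rho> \<le> card A"
    unfolding \<rho>_def using finite_AB by (intro moves_relocate_le)
  have cAB: "card (A \<union> B) \<le> k" by (rule card_block_le[OF C' P]) simp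
  have imAB: "\<rho> ` (A \<union> B) = {b}" using blockwise_image[OF bw, of "A \<union> B" b0] b0 \<rho>AB by auto
  have imB: "\<sigma> ` B = {b}" using blockwise_image[OF \<sigma>(2) BC b0] by (simp add: b_def)
  define rest where "rest s = (\<Sum>K\<in>C - {A, B}. if \<sigma> ` K = {s} then weight p k K else 0)" for s
  have sw: "server_weight p k C \<sigma> s = (if \<sigma> ` A = {s} then weight p k A else 0) + ((if b = s then weight p k B else 0) + rest s)" for s
    unfolding server_weight_def sum_C rest_def using imB by simp
  have "(\<Sum>K\<in>C - {A, B}. if \<rho> ` K = {s} then weight p k K else 0) = rest s" for s
    unfolding rest_def using \<rho>K by (intro sum.cong) auto
  then have sw': "server_weight p k C' \<rho> s = (if b = s then weight p k (A \<union> B) else 0) + rest s" for s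
    unfolding server_weight_def sum_C' using imAB by simp
  have swle: "server_weight p k C \<sigma> s \<le> p\<^sup>2" if "s < l" for s using pk that by (simp add: packed_def)
  have other: "server_weight p k C' \<rho> s \<le> p\<^sup>2" if "s < l" "s \<noteq> b" for s
    using swle[OF that(1)] that(2) unfolding sw sw' by simp
  show ?thesis
  proof (cases "weight p k B < weight p k (A \<union> B)")
    case False
    then have "weight p k (A \<union> B) = weight p k B"
      using weight_mono[of B "A \<union> B"] card_AB by simp
    then have "server_weight p k C' \<rho> b \<le> p\<^sup>2"
      using swle[OF bl] unfolding sw sw' by simp
    then have "packed C' \<rho>" using other \<rho> bw by (auto simp: packed_def)
    then show ?thesis using mv False by auto
  next
    case True
    define L where "L = {K \<in> C'. 0 < weight p k K}"
    define g where "g \<sigma> K = \<sigma> (SOME v. v \<in> K)" for \<sigma> :: "'v \<Rightarrow> nat" and K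
    have gV: "(SOME v. v \<in> K) \<in> V" "(SOME v. v \<in> K) \<in> K" if "K \<in> L" for K
      using that block_nonempty[OF C', of K] block_subset[OF C', of K]
      by (auto simp: L_def some_in_eq subset_iff)
    have Ppk: "packed C' P" by (rule perfect_imp_packed[OF C' P])
    have wt\<rho>: "(\<Sum>K | K \<in> L \<and> g \<rho> K = s. weight p k K) = server_weight p k C' \<rho> s" for s
      using server_weight_eq_sum_positive[OF C' bw, of s] by (simp add: L_def g_def)
    have wtP: "(\<Sum>K | K \<in> L \<and> g P K = s. weight p k K) = server_weight p k C' P s" for s
      using server_weight_eq_sum_positive[OF C', of P s] Ppk by (simp add: L_def g_def packed_def)
    \<comment> \<open>The fused block and the previous content of \<open>b\<close> contribute at
      most \<open>p\<^sup>2\<close> each, as \<open>repairable\<close> demands.\<close>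
    have "server_weight p k C' \<rho> b \<le> 2 * p\<^sup>2"
      using swle[OF bl] weight_le[OF cAB] unfolding sw sw' by simp
    moreover have "finite L" using finite_partition[OF C'] by (simp add: L_def)
    moreover have "g \<rho> ` L \<subseteq> {..<l}" "g P ` L \<subseteq> {..<l}"
      using gV \<rho> Ppk by (auto simp: g_def packed_def PiE_iff)
    ultimately obtain S h where S: "S \<subseteq> {..<l}" "card S \<le> N" and h: "h ` L \<subseteq> {..<l}"
      and hg: "\<And>K. K \<in> L \<Longrightarrow> g \<rho> K \<notin> S \<Longrightarrow> h K = g \<rho> K"
      and hw: "\<And>s. s < l \<Longrightarrow> (\<Sum>K | K \<in> L \<and> h K = s. weight p k K) \<le> p\<^sup>2"
      using repair[of L "weight p k" "g \<rho>" "g P" l b] bl other Ppk unfolding repairable_def wt\<rho> wtP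
      by (auto simp: L_def packed_def)
    define \<tau> where "\<tau> v = (if \<exists>K\<in>L. v \<in> K then h (THE K. K \<in> L \<and> v \<in> K) else \<rho> v)" for v
    have \<tau>L: "\<tau> v = h K" if K: "K \<in> L" "v \<in> K" for K v
    proof -
      have "(THE K. K \<in> L \<and> v \<in> K) = K"
        using K block_disjoint[OF C', of _ K] by (intro the_equality) (auto simp: L_def)
      then show ?thesis using K by (auto simp: \<tau>_def)
    qed
    have \<tau>notL: "\<tau> v = \<rho> v" if K: "K \<in> C'" "K \<notin> L" "v \<in> K" for K v
    proof -
      have "v \<notin> K'" if "K' \<in> L" for K'
        using that K block_disjoint[OF C', of K' K] unfolding L_def by blast
      then show ?thesis by (auto simp: \<tau>_def)
    qed
    have \<rho>g: "\<rho> v = g \<rho> K" if "K \<in> L" "v \<in> K" for K v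
      unfolding g_def using blockwiseD[OF bw _ that(2) gV(2)[OF that(1)]] that(1) by (simp add: L_def)
    have bw\<tau>: "blockwise C' \<tau>"
      unfolding blockwise_def
    proof (intro ballI)
      fix K u v assume K: "K \<in> C'" "u \<in> K" "v \<in> K"
      show "\<tau> u = \<tau> v"
      proof (cases "K \<in> L")
        case True
        then show ?thesis using \<tau>L K by simp
      next
        case False
        then have "\<tau> u = \<rho> u" "\<tau> v = \<rho> v" using \<tau>notL K by blast+
        then show ?thesis using blockwiseD[OF bw K] by simp
      qed
    qed
    have "packed C' \<tau>"
      unfolding packed_def
    proof (intro conjI allI impI)
      have "\<tau> v < l" if "v \<in> V" for v
      proof (cases "\<exists>K\<in>L. v \<in> K")
        case True
        then show ?thesis using \<tau>L h by auto
      next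
        case False
        then show ?thesis using \<rho> that by (auto simp: \<tau>_def)
      qed
      moreover have "\<tau> v = undefined" if "v \<notin> V" for v
      proof -
        have "\<not> (\<exists>K\<in>L. v \<in> K)" using that block_subset[OF C'] unfolding L_def by blast
        then show ?thesis using that \<rho> by (simp add: \<tau>_def PiE_iff extensional_def)
      qed
      ultimately show "\<tau> \<in> V \<rightarrow>\<^sub>E {..<l}" by (auto simp: PiE_iff extensional_def)
      show "blockwise C' \<tau>" by (rule bw\<tau>)
      fix s assume "s < l"
      have "server_weight p k C' \<tau> s = (\<Sum>K | K \<in> L \<and> g \<tau> K = s. weight p k K)"
        using server_weight_eq_sum_positive[OF C' bw\<tau>, of s] by (simp add: L_def g_def)
      also have "{K. K \<in> L \<and> g \<tau> K = s} = {K. K \<in> L \<and> h K = s}"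
        using \<tau>L[OF _ gV(2)] by (auto simp: g_def)
      finally show "server_weight p k C' \<tau> s \<le> p\<^sup>2" using hw[OF \<open>s < l\<close>] by simp
    qed
    moreover have "moves V \<rho> \<tau> \<le> 4 * N * k"
    proof -
      \<comment> \<open>Vertices leave only servers in \<open>S\<close>, so the loads of these
        servers bound the number of moves.\<close>
      have "\<rho> v \<in> S" if "\<tau> v \<noteq> \<rho> v" for v
      proof -
        obtain K where K: "K \<in> L" "v \<in> K" using \<open>\<tau> v \<noteq> \<rho> v\<close> by (auto simp: \<tau>_def split: if_splits)
        then show ?thesis using \<tau>L[OF K] \<rho>g[OF K] hg[OF K(1)] \<open>\<tau> v \<noteq> \<rho> v\<close> by auto
      qed
      then have "moves V \<rho> \<tau> \<le> card {v \<in> V. \<rho> v \<in> S}"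
        unfolding moves_def using finV by (intro card_mono) auto
      also have "\<dots> = (\<Sum>s\<in>S. load V \<rho> s)" using sum_load[OF S(1)] by simp
      also have "\<dots> \<le> (\<Sum>s\<in>S. 4 * k)"
      proof (rule sum_mono)
        fix s assume "s \<in> S"
        then have "p * load V \<sigma> s \<le> (p + 2) * k" using ld S(1) by auto
        \<comment> \<open>Since \<open>p\<close> is positive, \<open>p + 2\<close> is at most
          \<open>3 * p\<close>, so loads before the merge are at most \<open>3 * k\<close>; moving
          \<open>A\<close> adds at most \<open>k\<close>.\<close>
        also have "\<dots> \<le> (p * 3) * k" using p_pos by (intro mult_right_mono) auto
        also have "\<dots> = p * (3 * k)" by simp
        finally have "load V \<sigma> s \<le> 3 * k" using p_pos by simp
        moreover have "card A \<le> k" using cAB card_AB by simp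
        ultimately show "load V \<rho> s \<le> 4 * k" using load_le_moves[OF finV, of \<rho> s \<sigma>] mv by simp
      qed
      also have "\<dots> \<le> N * (4 * k)" using S(2) by simp
      finally show ?thesis by simp
    qed
    ultimately show ?thesis
      using True mv moves_triangle[OF finV, of \<sigma> \<tau> \<rho>] by (intro exI[of _ \<tau>]) auto
  qed
qed

end

section \<open>Amortised cost of a repacking step\<close>

definition (in servers) potential :: "'v set set \<Rightarrow> ('v \<Rightarrow> nat) \<Rightarrow> real" where
  "potential C \<sigma> = real (overload \<sigma>) + 2 * real p * log_potential k V C
     + 8 * (real p)\<^sup>2 * real N * real (weight_potential p k C)"

text \<open>A move made before rebalancing costs \<open>p\<close> and may raise
  \<open>overload\<close> by \<open>p\<close>, hence the factor \<open>2 * p\<close>. The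
  \<open>card A\<close> moves are paid by \<open>log_potential\<close>. A repair costs at most
  \<open>8 * p * N * k\<close>; it occurs only if the weight rises, and then
  \<open>weight_potential\<close> falls by at least \<open>card (A \<union> B)\<close>, which is at
  least \<open>k / p\<close>. The coefficients in \<open>potential\<close> match these
  amounts.\<close>

lemma (in merge) merge_step:
  assumes pk: "packed C \<sigma>" and ld: "\<forall>s<l. p * load V \<sigma> s \<le> (p + 2) * k"
  shows "\<exists>\<tau>. packed C' \<tau> \<and> (\<forall>s<l. p * load V \<tau> s \<le> (p + 2) * k)
    \<and> real p * real (moves V \<sigma> \<tau>) + potential C' \<tau> \<le> potential C \<sigma>"
proof -
  define ev where "ev \<longleftrightarrow> weight p k B < weight p k (A \<union> B)"
  obtain \<rho> where \<rho>: "packed C' \<rho>" "moves V \<sigma> \<rho> \<le> card A + (if ev then 4 * N * k else 0)"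
    using packed_merge_step[OF assms] unfolding ev_def by blast
  obtain \<tau> where \<tau>: "packed C' \<tau>" "\<forall>s<l. p * load V \<tau> s \<le> (p + 2) * k"
    "p * moves V \<rho> \<tau> + overload \<tau> \<le> overload \<rho>"
    using rebalance[OF C' \<rho>(1)] by blast
  have "p * moves V \<sigma> \<tau> \<le> p * moves V \<sigma> \<rho> + p * moves V \<rho> \<tau>"
    using moves_triangle[OF finV, of \<sigma> \<tau> \<rho>] by (metis add_mult_distrib2 mult_le_mono2)
  then have "p * moves V \<sigma> \<tau> + overload \<tau> \<le> overload \<sigma> + 2 * p * moves V \<sigma> \<rho>"
    using \<tau>(3) overload_le_moves[of \<rho> \<sigma>] by simp
  also have "\<dots> \<le> overload \<sigma> + 2 * p * (card A + (if ev then 4 * N * k else 0))"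
    using \<rho>(2) by (intro add_left_mono mult_le_mono2)
  finally have "real (p * moves V \<sigma> \<tau> + overload \<tau>)
      \<le> real (overload \<sigma> + 2 * p * (card A + (if ev then 4 * N * k else 0)))"
    by (simp only: of_nat_le_iff)
  then have 1: "real p * real (moves V \<sigma> \<tau>) + real (overload \<tau>)
      \<le> real (overload \<sigma>) + 2 * real p * real (card A) + (if ev then 8 * real p * real N * real k else 0)"
    by (simp add: algebra_simps split: if_splits)
  have "real (card A) \<le> (\<Sum>X\<in>{A, B}. if 2 * card X \<le> card (A \<union> B) \<and> X \<subseteq> V then real (card X) else 0)"
    using AB AleB card_AB block_subset[OF C AC] by simp
  then have "log_potential k V C' + real (card A) \<le> log_potential k V C"
    using log_potential_merge[of V] by linarith
  then have 2: "2 * real p * log_potential k V C' + 2 * real p * real (card A) \<le> 2 * real p * log_potential k V C"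
    unfolding distrib_left[symmetric] by (intro mult_left_mono) auto
  have 3: "8 * (real p)\<^sup>2 * real N * real (weight_potential p k C') + (if ev then 8 * real p * real N * real k else 0)
     \<le> 8 * (real p)\<^sup>2 * real N * real (weight_potential p k C)"
  proof (cases ev)
    case True
    then have "k \<le> p * card (A \<union> B)" by (auto simp: ev_def weight_def split: if_splits)
    then have "real k \<le> real p * real (card (A \<union> B))" by (metis of_nat_le_iff of_nat_mult)
    then have "8 * real p * real N * real k \<le> 8 * real p * real N * (real p * real (card (A \<union> B)))"
      by (intro mult_left_mono) auto
    also have "\<dots> = 8 * (real p)\<^sup>2 * real N * real (card (A \<union> B))" by (simp add: power2_eq_square)
    finally have "8 * (real p)\<^sup>2 * real N * real (weight_potential p k C') + 8 * real p * real N * real k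
       \<le> 8 * (real p)\<^sup>2 * real N * (real (weight_potential p k C') + real (card (A \<union> B)))"
      by (simp add: distrib_left)
    also have "\<dots> \<le> 8 * (real p)\<^sup>2 * real N * real (weight_potential p k C)"
      using weight_potential_merge True unfolding ev_def
      by (intro mult_left_mono) (auto simp flip: of_nat_add)
    finally show ?thesis using True by simp
  next
    case False
    then show ?thesis using weight_potential_merge by (auto intro!: mult_left_mono)
  qed
  have "real p * real (moves V \<sigma> \<tau>) + potential C' \<tau> \<le> potential C \<sigma>"
    using 1 2 3 unfolding potential_def by linarith
  then show ?thesis using \<tau> by blast
qed

section \<open>Majority placement\<close>

context servers
begin

text \<open>Blocks without a dominating initial server may lie anywhere, so their place can depend
  on the history.\<close>

definition majority_placed :: "('v \<Rightarrow> nat) \<Rightarrow> 'v set set \<Rightarrow> ('v \<Rightarrow> nat) \<Rightarrow> bool" where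
  "majority_placed \<sigma>\<^sub>0 C \<sigma> \<longleftrightarrow> \<sigma> \<in> V \<rightarrow>\<^sub>E {..<l} \<and> blockwise C \<sigma> \<and>
     (\<forall>K\<in>C. \<forall>c. 7 * card K < 8 * card {v \<in> K. \<sigma>\<^sub>0 v = c} \<longrightarrow> (\<forall>v\<in>K. \<sigma> v = c))"

lemma moves_eq_sum_blocks:
  assumes C: "partition_on V C"
  shows "moves V \<sigma> \<tau> = (\<Sum>K\<in>C. card {v \<in> K. \<tau> v \<noteq> \<sigma> v})"
proof -
  have "{v \<in> V. \<tau> v \<noteq> \<sigma> v} = (\<Union>K\<in>C. {v \<in> K. \<tau> v \<noteq> \<sigma> v})"
    using partition_onD1[OF C] by auto
  then show ?thesis
    unfolding moves_def using finite_partition[OF C] finite_block[OF C]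
    by (simp only:) (rule card_UN_disjoint, auto dest: block_disjoint[OF C])
qed

lemma card_agree_disagree:
  assumes "finite K"
  shows "card {v \<in> K. \<sigma>\<^sub>0 v = c} + card {v \<in> K. c \<noteq> \<sigma>\<^sub>0 v} = card K"
proof -
  have "card ({v \<in> K. \<sigma>\<^sub>0 v = c} \<union> {v \<in> K. c \<noteq> \<sigma>\<^sub>0 v}) = card {v \<in> K. \<sigma>\<^sub>0 v = c} + card {v \<in> K. c \<noteq> \<sigma>\<^sub>0 v}"
    using assms by (intro card_Un_disjoint) auto
  moreover have "{v \<in> K. \<sigma>\<^sub>0 v = c} \<union> {v \<in> K. c \<noteq> \<sigma>\<^sub>0 v} = K" by auto
  ultimately show ?thesis by simp
qed

text \<open>If \<open>t\<close> holds at most \<open>7/8\<close> of \<open>K\<close> initially, then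
  putting \<open>K\<close> on \<open>t\<close> displaces at least \<open>1/8\<close> of it. Such
  displaced blocks are the ones to which moves are charged.\<close>

lemma dominated_or_spoiled:
  assumes "finite K" "\<And>v. v \<in> K \<Longrightarrow> P v = t"
  shows "7 * card K < 8 * card {v \<in> K. \<sigma>\<^sub>0 v = t} \<or> card K \<le> 8 * card {v \<in> K. P v \<noteq> \<sigma>\<^sub>0 v}"
proof -
  have "{v \<in> K. P v \<noteq> \<sigma>\<^sub>0 v} = {v \<in> K. t \<noteq> \<sigma>\<^sub>0 v}" using assms(2) by auto
  then show ?thesis using card_agree_disagree[OF assms(1), of \<sigma>\<^sub>0 t] by presburger
qed

text \<open>Compared block by block: either \<open>P\<close> uses the dominating server, and then
  both assignments agree on the block, or \<open>P\<close> displaces at least \<open>1/8\<close> of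
  it.\<close>

lemma majority_placed_moves_le:
  assumes C: "partition_on V C" and mp: "majority_placed \<sigma>\<^sub>0 C \<sigma>" and P: "blockwise C P"
  shows "moves V \<sigma>\<^sub>0 \<sigma> \<le> 8 * moves V \<sigma>\<^sub>0 P"
  unfolding moves_eq_sum_blocks[OF C] sum_distrib_left
proof (rule sum_mono)
  fix K assume K: "K \<in> C"
  then obtain w where w: "w \<in> K" using block_nonempty[OF C] by blast
  have Pw: "P v = P w" if "v \<in> K" for v using blockwiseD[OF P K that w] .
  from dominated_or_spoiled[OF finite_block[OF C K] Pw]
  show "card {v \<in> K. \<sigma> v \<noteq> \<sigma>\<^sub>0 v} \<le> 8 * card {v \<in> K. P v \<noteq> \<sigma>\<^sub>0 v}"
  proof
    assume "7 * card K < 8 * card {v \<in> K. \<sigma>\<^sub>0 v = P w}"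
    then have "\<sigma> v = P v" if "v \<in> K" for v using mp K that Pw[OF that] unfolding majority_placed_def by auto
    then have "{v \<in> K. \<sigma> v \<noteq> \<sigma>\<^sub>0 v} = {v \<in> K. P v \<noteq> \<sigma>\<^sub>0 v}" by auto
    then show ?thesis by simp
  next
    assume "card K \<le> 8 * card {v \<in> K. P v \<noteq> \<sigma>\<^sub>0 v}"
    moreover have "card {v \<in> K. \<sigma> v \<noteq> \<sigma>\<^sub>0 v} \<le> card K"
      using finite_block[OF C K] by (intro card_mono) auto
    ultimately show ?thesis by simp
  qed
qed

end

text \<open>The new assignment \<open>\<tau>\<close> is chosen before \<open>Q\<close> and
  \<open>D\<close> are quantified, since the algorithm does not know the optimum. A moved part at
  most half as large as the union is paid by \<open>log_potential\<close>; a larger part moves only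
  towards its initial server, and then the decrease of the distance to
  \<open>\<sigma>\<^sub>0\<close> pays.\<close>

lemma (in merge) majority_merge_step:
  assumes mp: "majority_placed \<sigma>\<^sub>0 C \<sigma>" and \<sigma>0: "\<sigma>\<^sub>0 \<in> V \<rightarrow>\<^sub>E {..<l}"
  shows "\<exists>\<tau>. majority_placed \<sigma>\<^sub>0 C' \<tau> \<and>
    (\<forall>Q D. blockwise C' Q \<and> (\<forall>K\<in>C \<union> C'. card K \<le> 8 * card {v \<in> K. Q v \<noteq> \<sigma>\<^sub>0 v} \<longrightarrow> K \<subseteq> D) \<longrightarrow>
      real (moves V \<sigma> \<tau>) + 2 * real (moves V \<sigma>\<^sub>0 \<tau>) + 3 * log_potential k D C'
        \<le> 2 * real (moves V \<sigma>\<^sub>0 \<sigma>) + 3 * log_potential k D C)"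
proof -
  define dom where "dom K c \<longleftrightarrow> 7 * card K < 8 * card {v \<in> K. \<sigma>\<^sub>0 v = c}" for K c
  have \<sigma>: "\<sigma> \<in> V \<rightarrow>\<^sub>E {..<l}" "blockwise C \<sigma>"
    and \<sigma>dom: "\<And>K c v. K \<in> C \<Longrightarrow> dom K c \<Longrightarrow> v \<in> K \<Longrightarrow> \<sigma> v = c"
    using mp unfolding majority_placed_def dom_def by blast+
  obtain b0 where b0: "b0 \<in> B" using block_nonempty[OF C BC] by blast
  have sub: "A \<subseteq> V" "B \<subseteq> V" using block_subset[OF C] AC BC by auto
  have fAB: "finite (A \<union> B)" using finite_AB by simp
  have dom_unique: "c = c'" if "dom (A \<union> B) c" "dom (A \<union> B) c'" for c c'
  proof (rule ccontr)
    assume "c \<noteq> c'"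
    then have "card {v \<in> A \<union> B. \<sigma>\<^sub>0 v = c} \<le> card {v \<in> A \<union> B. c' \<noteq> \<sigma>\<^sub>0 v}"
      using fAB by (intro card_mono) auto
    then show False using that card_agree_disagree[OF fAB, of \<sigma>\<^sub>0 c'] unfolding dom_def by linarith
  qed
  \<comment> \<open>Without a dominating server the union goes to the place of the larger part
    \<open>B\<close>.\<close>
  define s where "s = (if \<exists>c. dom (A \<union> B) c then SOME c. dom (A \<union> B) c else \<sigma> b0)"
  have s_dom: "s = c" if "dom (A \<union> B) c" for c
    using that dom_unique someI[of "dom (A \<union> B)" c] by (auto simp: s_def)
  have s_cases: "dom (A \<union> B) s \<or> s = \<sigma> b0"
    using s_dom by (cases "\<exists>c. dom (A \<union> B) c") (auto simp: s_def)
  have "s < l"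
  proof (cases "dom (A \<union> B) s")
    case True
    then have "card {v \<in> A \<union> B. \<sigma>\<^sub>0 v = s} \<noteq> 0" by (auto simp: dom_def)
    then obtain v where "v \<in> A \<union> B" "\<sigma>\<^sub>0 v = s" by (metis (mono_tags, lifting) card.empty empty_Collect_eq)
    then show ?thesis using \<sigma>0 sub by auto
  next
    case False
    then show ?thesis using s_cases \<sigma>(1) b0 sub by auto
  qed
  define \<tau> where "\<tau> = relocate (A \<union> B) s \<sigma>"
  have \<tau>AB: "\<tau> v = s" if "v \<in> A \<union> B" for v using that by (simp add: \<tau>_def relocate_def)
  have \<tau>rest: "\<tau> v = \<sigma> v" if "K \<in> C - {A, B}" "v \<in> K" for K v
    using disj_rest[OF that(1)] that(2) by (auto simp: \<tau>_def relocate_def)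
  have "majority_placed \<sigma>\<^sub>0 C' \<tau>"
    unfolding majority_placed_def
  proof (intro conjI ballI allI impI)
    show "\<tau> \<in> V \<rightarrow>\<^sub>E {..<l}"
      using \<sigma>(1) \<open>s < l\<close> sub by (auto simp: \<tau>_def relocate_def PiE_iff extensional_def)
    show "blockwise C' \<tau>"
      unfolding blockwise_def
    proof (intro ballI)
      fix K u v assume K: "K \<in> C'" "u \<in> K" "v \<in> K"
      show "\<tau> u = \<tau> v"
      proof (cases "K = A \<union> B")
        case False
        then have "K \<in> C - {A, B}" using K(1) by simp
        then show ?thesis using \<tau>rest K(2,3) blockwiseD[OF \<sigma>(2) _ K(2,3)] by simp
      qed (use K \<tau>AB in simp)
    qed
    fix K c v assume K: "K \<in> C'" "7 * card K < 8 * card {v \<in> K. \<sigma>\<^sub>0 v = c}" "v \<in> K"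
    then have d: "dom K c" by (simp add: dom_def)
    show "\<tau> v = c"
    proof (cases "K = A \<union> B")
      case True
      then show ?thesis using s_dom d \<tau>AB K(3) by auto
    next
      case False
      then have "K \<in> C - {A, B}" using K(1) by simp
      then show ?thesis using \<tau>rest[OF _ K(3)] \<sigma>dom[OF _ d K(3)] by simp
    qed
  qed
  moreover have "real (moves V \<sigma> \<tau>) + 2 * real (moves V \<sigma>\<^sub>0 \<tau>) + 3 * log_potential k D C'
        \<le> 2 * real (moves V \<sigma>\<^sub>0 \<sigma>) + 3 * log_potential k D C"
    if Q: "blockwise C' Q" and D: "\<forall>K\<in>C \<union> C'. card K \<le> 8 * card {v \<in> K. Q v \<noteq> \<sigma>\<^sub>0 v} \<longrightarrow> K \<subseteq> D" for Q D
  proof -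
    define drop where "drop X = (if 2 * card X \<le> card (A \<union> B) \<and> X \<subseteq> D then card X else 0)" for X
    define m where "m X = card {v \<in> X. \<tau> v \<noteq> \<sigma> v}" for X
    define d where "d X = card {v \<in> X. \<sigma> v \<noteq> \<sigma>\<^sub>0 v}" for X
    define d' where "d' X = card {v \<in> X. \<tau> v \<noteq> \<sigma>\<^sub>0 v}" for X
    have step: "m X + 2 * d' X \<le> 2 * d X + 3 * drop X" if X: "X \<in> {A, B}" for X
    proof -
      have XC: "X \<in> C" and XAB: "X \<subseteq> A \<union> B" using X AC BC by auto
      have finX: "finite X" using finite_block[OF C XC] .
      obtain x where x: "x \<in> X" using block_nonempty[OF C XC] by blast
      have \<sigma>X: "\<sigma> v = \<sigma> x" if "v \<in> X" for v using blockwiseD[OF \<sigma>(2) XC that x] .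
      have \<tau>X: "\<tau> v = s" if "v \<in> X" for v using \<tau>AB that XAB by auto
      have le: "m X \<le> card X" "d' X \<le> card X"
        unfolding m_def d'_def using finX by (auto intro: card_mono)
      show ?thesis
      proof (cases "\<sigma> x = s")
        case True
        then have "\<tau> v = \<sigma> v" if "v \<in> X" for v using \<sigma>X \<tau>X that by simp
        then have "{v \<in> X. \<tau> v \<noteq> \<sigma> v} = {}" "{v \<in> X. \<tau> v \<noteq> \<sigma>\<^sub>0 v} = {v \<in> X. \<sigma> v \<noteq> \<sigma>\<^sub>0 v}" by auto
        then show ?thesis unfolding m_def d_def d'_def by (simp only: card.empty)
      next
        case False
        have QX: "Q v = Q x" if "v \<in> A \<union> B" for v
          using blockwiseD[OF Q _ that, of x] x XAB by auto
        \<comment> \<open>Were both dominated by \<open>Q x\<close>, then \<open>\<sigma> x\<close>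
          and \<open>s\<close> would both equal \<open>Q x\<close>. So \<open>Q\<close> displaces at
          least \<open>1/8\<close> of \<open>X\<close> or of the union, and \<open>X\<close> lies in
          \<open>D\<close> either way.\<close>
        have "\<not> (dom X (Q x) \<and> dom (A \<union> B) (Q x))"
          using False s_dom \<sigma>dom[OF XC _ x] by auto
        then have "X \<subseteq> D"
          using dominated_or_spoiled[OF finX, of Q "Q x" \<sigma>\<^sub>0] dominated_or_spoiled[OF fAB, of Q "Q x" \<sigma>\<^sub>0]
            QX XAB XC D unfolding dom_def by blast
        show ?thesis
        proof (cases "2 * card X \<le> card (A \<union> B)")
          case True
          then show ?thesis using \<open>X \<subseteq> D\<close> le by (simp add: drop_def)
        next
          case big: False
          \<comment> \<open>Otherwise \<open>s\<close> is the place of \<open>B\<close>, so the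
            moved part is \<open>A\<close>, which is at most half of the union.\<close>
          have "dom (A \<union> B) s"
          proof (rule ccontr)
            assume "\<not> dom (A \<union> B) s"
            then have "s = \<sigma> b0" using s_cases by simp
            then have "X \<noteq> B" using False \<sigma>X[of b0] b0 by auto
            then show False using X big AleB card_AB by auto
          qed
          then have 1: "7 * card (A \<union> B) < 8 * card {v \<in> A \<union> B. \<sigma>\<^sub>0 v = s}" by (simp add: dom_def)
          have "card {v \<in> A \<union> B. \<sigma>\<^sub>0 v = s} \<le> card ({v \<in> X. \<sigma>\<^sub>0 v = s} \<union> ((A \<union> B) - X))"
            using fAB finX by (intro card_mono) auto
          also have "\<dots> \<le> card {v \<in> X. \<sigma>\<^sub>0 v = s} + card ((A \<union> B) - X)" by (rule card_Un_le)
          finally have 2: "card {v \<in> A \<union> B. \<sigma>\<^sub>0 v = s} + card X \<le> card {v \<in> X. \<sigma>\<^sub>0 v = s} + card (A \<union> B)"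
            using card_Diff_subset[OF finX XAB] card_mono[OF fAB XAB] by simp
          have 3: "card {v \<in> X. \<sigma>\<^sub>0 v = s} \<le> d X"
            unfolding d_def using finX \<sigma>X False by (intro card_mono) auto
          have "d' X = card {v \<in> X. s \<noteq> \<sigma>\<^sub>0 v}"
            unfolding d'_def using \<tau>X by (intro arg_cong[of _ _ card]) auto
          then have 4: "card {v \<in> X. \<sigma>\<^sub>0 v = s} + d' X = card X"
            using card_agree_disagree[OF finX, of \<sigma>\<^sub>0 s] by simp
          \<comment> \<open>More than \<open>7/8\<close> of the union starts on \<open>s\<close>,
            and \<open>X\<close> is more than half of it, so more than \<open>3/4\<close> of
            \<open>X\<close> starts on \<open>s\<close>. Thus \<open>d X\<close> exceeds
            \<open>3/4\<close> and \<open>d' X\<close> is below \<open>1/4\<close> of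
            \<open>card X\<close>, which is just enough to pay for \<open>card X\<close>
            moves.\<close>
          from 1 2 3 4 big le(1) show ?thesis by linarith
        qed
      qed
    qed
    have "m K = 0" "d' K = d K" if "K \<in> C - {A, B}" for K
    proof -
      have "{v \<in> K. \<tau> v \<noteq> \<sigma> v} = {}" "{v \<in> K. \<tau> v \<noteq> \<sigma>\<^sub>0 v} = {v \<in> K. \<sigma> v \<noteq> \<sigma>\<^sub>0 v}"
        using \<tau>rest[OF that] by auto
      then show "m K = 0" "d' K = d K" unfolding m_def d_def d'_def by (simp_all only: card.empty)
    qed
    then have rest: "sum m (C - {A, B}) = 0" "sum d' (C - {A, B}) = sum d (C - {A, B})"
      by (auto intro: sum.neutral sum.cong)
    have "moves V \<sigma> \<tau> + 2 * moves V \<sigma>\<^sub>0 \<tau> = sum m C + 2 * sum d' C"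
      unfolding moves_eq_sum_blocks[OF C] m_def d'_def ..
    also have "\<dots> \<le> 2 * sum d C + 3 * (drop A + drop B)"
      unfolding sum_C rest using step[of A] step[of B] by simp
    also have "sum d C = moves V \<sigma>\<^sub>0 \<sigma>" unfolding moves_eq_sum_blocks[OF C] d_def ..
    finally have "real (moves V \<sigma> \<tau> + 2 * moves V \<sigma>\<^sub>0 \<tau>) \<le> real (2 * moves V \<sigma>\<^sub>0 \<sigma> + 3 * (drop A + drop B))"
      by (simp only: of_nat_le_iff)
    moreover have "(\<Sum>X\<in>{A, B}. if 2 * card X \<le> card (A \<union> B) \<and> X \<subseteq> D then real (card X) else 0) = real (drop A + drop B)"
      using AB by (simp add: drop_def)
    ultimately show ?thesis using log_potential_merge[of D] by simp
  qed
  ultimately show ?thesis by blast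
qed

section \<open>The online algorithm\<close>

context servers
begin

lemma perfect_iff_feasible: "perfect (connected_components V E) P \<longleftrightarrow> feasible V l (real k) E P"
  by (simp add: perfect_def feasible_def cc_condition_blockwise conj_ac)

lemma perfect_antimono:
  "E \<subseteq> E' \<Longrightarrow> perfect (connected_components V E') P \<Longrightarrow> perfect (connected_components V E) P"
  unfolding perfect_iff_feasible feasible_def using cc_condition_antimono[of E E' V P] by simp

text \<open>The condition for the first phase. The factor \<open>8\<close> is the one of
  \<open>majority_placed_moves_le\<close>, so the algorithm stays within
  \<open>\<epsilon> * k\<close> moves of \<open>\<sigma>\<^sub>0\<close>.\<close>

definition near :: "real \<Rightarrow> ('v \<Rightarrow> nat) \<Rightarrow> 'v set set \<Rightarrow> bool" where
  "near \<epsilon> \<sigma>\<^sub>0 E \<longleftrightarrow> (\<exists>P. perfect (connected_components V E) P \<and> 8 * real (moves V \<sigma>\<^sub>0 P) \<le> \<epsilon> * real k)"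

text \<open>Consequently the first phase, once left, is never entered again.\<close>

lemma near_antimono: "E \<subseteq> E' \<Longrightarrow> near \<epsilon> \<sigma>\<^sub>0 E' \<Longrightarrow> near \<epsilon> \<sigma>\<^sub>0 E"
  unfolding near_def using perfect_antimono[of E E'] by blast

definition invariant :: "real \<Rightarrow> ('v \<Rightarrow> nat) \<Rightarrow> 'v set set \<Rightarrow> ('v \<Rightarrow> nat) \<Rightarrow> bool" where
  "invariant \<epsilon> \<sigma>\<^sub>0 E \<sigma> \<longleftrightarrow>
     (if near \<epsilon> \<sigma>\<^sub>0 E then majority_placed \<sigma>\<^sub>0 (connected_components V E) \<sigma>
      else packed (connected_components V E) \<sigma> \<and> (\<forall>s<l. p * load V \<sigma> s \<le> (p + 2) * k))"

text \<open>The specification from which the algorithm selects its next assignment. It involves only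
  edges already revealed; the unknown optimum enters through the quantified \<open>Q\<close> and
  \<open>D\<close>. The last clause starts the second phase without excess load, so that its
  potential is bounded.\<close>

definition good_step :: "real \<Rightarrow> ('v \<Rightarrow> nat) \<Rightarrow> 'v set set \<Rightarrow> 'v set set \<Rightarrow> ('v \<Rightarrow> nat) \<Rightarrow> ('v \<Rightarrow> nat) \<Rightarrow> bool" where
  "good_step \<epsilon> \<sigma>\<^sub>0 E E' \<sigma> \<tau> \<longleftrightarrow> invariant \<epsilon> \<sigma>\<^sub>0 E' \<tau> \<and>
     (near \<epsilon> \<sigma>\<^sub>0 E' \<longrightarrow> (\<forall>Q D. blockwise (connected_components V E') Q \<and>
         (\<forall>K\<in>connected_components V E \<union> connected_components V E'.
            card K \<le> 8 * card {v \<in> K. Q v \<noteq> \<sigma>\<^sub>0 v} \<longrightarrow> K \<subseteq> D) \<longrightarrow>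
         real (moves V \<sigma> \<tau>) + 2 * real (moves V \<sigma>\<^sub>0 \<tau>) + 3 * log_potential k D (connected_components V E')
           \<le> 2 * real (moves V \<sigma>\<^sub>0 \<sigma>) + 3 * log_potential k D (connected_components V E))) \<and>
     (\<not> near \<epsilon> \<sigma>\<^sub>0 E \<longrightarrow>
         real p * real (moves V \<sigma> \<tau>) + potential (connected_components V E') \<tau>
           \<le> potential (connected_components V E) \<sigma>) \<and>
     (near \<epsilon> \<sigma>\<^sub>0 E \<and> \<not> near \<epsilon> \<sigma>\<^sub>0 E' \<longrightarrow> overload \<tau> = 0)"

text \<open>If no components fuse, nothing moves within a phase. A merge is handled by
  \<open>majority_merge_step\<close> in the first phase and by \<open>merge_step\<close> in the
  second.\<close>

lemma ex_good_step:
  assumes \<sigma>0: "\<sigma>\<^sub>0 \<in> V \<rightarrow>\<^sub>E {..<l}" and e: "e \<subseteq> V" "card e = 2"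
    and P: "perfect (connected_components V (insert e E)) P" and inv: "invariant \<epsilon> \<sigma>\<^sub>0 E \<sigma>"
  shows "\<exists>\<tau>. good_step \<epsilon> \<sigma>\<^sub>0 E (insert e E) \<sigma> \<tau>"
proof -
  define C where "C = connected_components V E"
  define C' where "C' = connected_components V (insert e E)"
  have part: "partition_on V C" "partition_on V C'"
    unfolding C_def C'_def by (rule partition_on_components)+
  consider (same) "C' = C" | (merge) A B where "merge V l k p N C A B P" "C' = insert (A \<union> B) (C - {A, B})"
  proof -
    have "merge V l k p N C A B P" if "A \<in> C" "B \<in> C" "A \<noteq> B" "card A \<le> card B" "C' = insert (A \<union> B) (C - {A, B})" for A B
      using that part P C'_def by unfold_locales simp_all
    moreover have "C' = C \<or> (\<exists>A\<in>C. \<exists>B\<in>C. A \<noteq> B \<and> card A \<le> card B \<and> C' = insert (A \<union> B) (C - {A, B}))"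
      using components_insert[OF e, of E] unfolding C_def C'_def .
    ultimately show ?thesis using that by (elim disjE bexE conjE) blast+
  qed
  note cases = this
  have mono: "near \<epsilon> \<sigma>\<^sub>0 (insert e E) \<Longrightarrow> near \<epsilon> \<sigma>\<^sub>0 E" by (rule near_antimono[rotated]) auto
  show ?thesis
  proof (cases "near \<epsilon> \<sigma>\<^sub>0 E")
    case True
    show ?thesis
    proof (cases "near \<epsilon> \<sigma>\<^sub>0 (insert e E)")
      case near': True
      have mp: "majority_placed \<sigma>\<^sub>0 C \<sigma>" using inv True by (simp add: invariant_def C_def)
      from cases show ?thesis
      proof cases
        case same
        then have "good_step \<epsilon> \<sigma>\<^sub>0 E (insert e E) \<sigma> \<sigma>"
          using mp near' True unfolding good_step_def invariant_def C_def[symmetric] C'_def[symmetric] by simp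
        then show ?thesis by blast
      next
        case (merge A B)
        interpret merge V l k p N C A B P by (rule merge(1))
        obtain \<tau> where \<tau>: "majority_placed \<sigma>\<^sub>0 C' \<tau>"
          "\<forall>Q D. blockwise C' Q \<and> (\<forall>K\<in>C \<union> C'. card K \<le> 8 * card {v \<in> K. Q v \<noteq> \<sigma>\<^sub>0 v} \<longrightarrow> K \<subseteq> D) \<longrightarrow>
            real (moves V \<sigma> \<tau>) + 2 * real (moves V \<sigma>\<^sub>0 \<tau>) + 3 * log_potential k D C'
            \<le> 2 * real (moves V \<sigma>\<^sub>0 \<sigma>) + 3 * log_potential k D C"
          using majority_merge_step[OF mp \<sigma>0] unfolding merge(2) by blast
        then have "good_step \<epsilon> \<sigma>\<^sub>0 E (insert e E) \<sigma> \<tau>"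
          using near' True unfolding good_step_def invariant_def C_def[symmetric] C'_def[symmetric] by simp
        then show ?thesis by blast
      qed
    next
      case False
      \<comment> \<open>At the phase change the algorithm jumps to the perfect assignment
        \<open>P\<close> itself, which has no overload. This happens only once, so even moving all
        vertices is affordable.\<close>
      have "packed C' P" using perfect_imp_packed[OF part(2)] P by (simp add: C'_def)
      moreover have ld: "p * load V P s \<le> p * k" if "s < l" for s using P that by (simp add: perfect_def)
      have "p * load V P s \<le> (p + 2) * k" if "s < l" for s
        using ld[OF that] by (rule le_trans) simp
      moreover have "p * load V P s \<le> (p + 1) * k" if "s < l" for s
        using ld[OF that] by (rule le_trans) simp
      then have "overload P = 0"
        unfolding overload_def by (intro sum.neutral ballI) (simp only: diff_is_0_eq lessThan_iff)
      ultimately have "good_step \<epsilon> \<sigma>\<^sub>0 E (insert e E) \<sigma> P"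
        using False True unfolding good_step_def invariant_def C'_def[symmetric] by simp
      then show ?thesis by blast
    qed
  next
    case False
    then have False': "\<not> near \<epsilon> \<sigma>\<^sub>0 (insert e E)" using mono by blast
    have pk: "packed C \<sigma>" "\<forall>s<l. p * load V \<sigma> s \<le> (p + 2) * k"
      using inv False by (auto simp: invariant_def C_def)
    from cases show ?thesis
    proof cases
      case same
      then have "good_step \<epsilon> \<sigma>\<^sub>0 E (insert e E) \<sigma> \<sigma>"
        using pk False False' unfolding good_step_def invariant_def C_def[symmetric] C'_def[symmetric] by simp
      then show ?thesis by blast
    next
      case (merge A B)
      interpret merge V l k p N C A B P by (rule merge(1))
      obtain \<tau> where "packed C' \<tau>" "\<forall>s<l. p * load V \<tau> s \<le> (p + 2) * k"
        "real p * real (moves V \<sigma> \<tau>) + potential C' \<tau> \<le> potential C \<sigma>"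
        using merge_step[OF pk] unfolding merge(2) by blast
      then have "good_step \<epsilon> \<sigma>\<^sub>0 E (insert e E) \<sigma> \<tau>"
        using False False' unfolding good_step_def invariant_def C_def[symmetric] C'_def[symmetric] by simp
      then show ?thesis by blast
    qed
  qed
qed

section \<open>The algorithm and its feasibility\<close>

text \<open>The most recent edge comes first.\<close>

primrec server_algorithm :: "real \<Rightarrow> ('v \<Rightarrow> nat) \<Rightarrow> 'v set list \<Rightarrow> 'v \<Rightarrow> nat" where
  "server_algorithm \<epsilon> \<sigma>\<^sub>0 [] = \<sigma>\<^sub>0"
| "server_algorithm \<epsilon> \<sigma>\<^sub>0 (e # es) =
     (SOME \<tau>. good_step \<epsilon> \<sigma>\<^sub>0 (set es) (insert e (set es)) (server_algorithm \<epsilon> \<sigma>\<^sub>0 es) \<tau>)"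

lemma initial_perfect:
  "initial_assignment V l k \<sigma>\<^sub>0 \<Longrightarrow> perfect (connected_components V {}) \<sigma>\<^sub>0"
  by (auto simp: initial_assignment_def perfect_def components_empty blockwise_def)

lemma invariant_initial:
  assumes "initial_assignment V l k \<sigma>\<^sub>0" "0 \<le> \<epsilon>"
  shows "invariant \<epsilon> \<sigma>\<^sub>0 {} \<sigma>\<^sub>0"
proof -
  have "near \<epsilon> \<sigma>\<^sub>0 {}"
    unfolding near_def using initial_perfect[OF assms(1)] assms(2) by (intro exI[of _ \<sigma>\<^sub>0]) simp
  moreover have "majority_placed \<sigma>\<^sub>0 (connected_components V {}) \<sigma>\<^sub>0"
    unfolding majority_placed_def
  proof (intro conjI ballI allI impI)
    show "\<sigma>\<^sub>0 \<in> V \<rightarrow>\<^sub>E {..<l}" "blockwise (connected_components V {}) \<sigma>\<^sub>0"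
      using initial_perfect[OF assms(1)] by (auto simp: perfect_def)
    fix K c v assume K: "K \<in> connected_components V {}" "7 * card K < 8 * card {v \<in> K. \<sigma>\<^sub>0 v = c}" "v \<in> K"
    then have "K = {v}" by (auto simp: components_empty)
    moreover have "{v \<in> K. \<sigma>\<^sub>0 v = c} \<noteq> {}" using K(2) by (metis card.empty mult_0_right not_less_zero)
    ultimately show "\<sigma>\<^sub>0 v = c" by blast
  qed
  ultimately show ?thesis by (simp add: invariant_def)
qed

text \<open>In the first phase loads exceed \<open>k\<close> by at most the distance to
  \<open>\<sigma>\<^sub>0\<close>, hence by at most \<open>\<epsilon> * k\<close>. In the second
  phase the relative excess is at most \<open>2 / p\<close>, and this is at most
  \<open>\<epsilon>\<close>.\<close>

lemma invariant_feasible: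
  assumes init: "initial_assignment V l k \<sigma>\<^sub>0" and inv: "invariant \<epsilon> \<sigma>\<^sub>0 E \<sigma>" and p: "2 \<le> \<epsilon> * real p"
  shows "feasible V l ((1 + \<epsilon>) * real k) E \<sigma>"
proof (cases "near \<epsilon> \<sigma>\<^sub>0 E")
  case True
  then have mp: "majority_placed \<sigma>\<^sub>0 (connected_components V E) \<sigma>" using inv by (simp add: invariant_def)
  obtain P where P: "perfect (connected_components V E) P" "8 * real (moves V \<sigma>\<^sub>0 P) \<le> \<epsilon> * real k"
    using True by (auto simp: near_def)
  have mv: "moves V \<sigma>\<^sub>0 \<sigma> \<le> 8 * moves V \<sigma>\<^sub>0 P"
    using P(1) by (intro majority_placed_moves_le[OF partition_on_components mp]) (simp add: perfect_def)
  have "real (load V \<sigma> s) \<le> (1 + \<epsilon>) * real k" if "s < l" for s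
  proof -
    have "load V \<sigma> s \<le> k + 8 * moves V \<sigma>\<^sub>0 P"
      using load_le_moves[OF finV, of \<sigma> s \<sigma>\<^sub>0] mv init that by (simp add: initial_assignment_def)
    then have "real (load V \<sigma> s) \<le> real k + 8 * real (moves V \<sigma>\<^sub>0 P)" by linarith
    then show ?thesis using P(2) by (simp add: algebra_simps)
  qed
  then show ?thesis
    using mp by (simp add: feasible_def majority_placed_def cc_condition_blockwise)
next
  case False
  then have pk: "packed (connected_components V E) \<sigma>" "\<forall>s<l. p * load V \<sigma> s \<le> (p + 2) * k"
    using inv by (auto simp: invariant_def)
  have "real (load V \<sigma> s) \<le> (1 + \<epsilon>) * real k" if "s < l" for s
  proof -
    have "real (p * load V \<sigma> s) \<le> real ((p + 2) * k)" using pk(2) that by (simp only: of_nat_le_iff)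
    then have "real p * real (load V \<sigma> s) \<le> (real p + 2) * real k" by (simp add: distrib_right)
    also have "\<dots> \<le> (real p + \<epsilon> * real p) * real k" using p by (intro mult_right_mono) auto
    also have "\<dots> = real p * ((1 + \<epsilon>) * real k)" by (simp add: algebra_simps)
    finally show ?thesis using p_pos by simp
  qed
  then show ?thesis
    using pk(1) by (simp add: feasible_def packed_def cc_condition_blockwise)
qed

text \<open>The two claims support each other: the invariant makes the choice in
  \<open>server_algorithm\<close> meaningful by \<open>ex_good_step\<close>, and a good step
  restores the invariant.\<close>

lemma server_algorithm_good_step:
  assumes init: "initial_assignment V l k \<sigma>\<^sub>0" and req: "request_sequence V l k es" and \<epsilon>: "0 \<le> \<epsilon>"
  defines "r \<equiv> \<lambda>i. server_algorithm \<epsilon> \<sigma>\<^sub>0 (rev (take i es))"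
  shows "i \<le> length es \<Longrightarrow> invariant \<epsilon> \<sigma>\<^sub>0 (set (take i es)) (r i)"
    and "i < length es \<Longrightarrow> good_step \<epsilon> \<sigma>\<^sub>0 (set (take i es)) (set (take (Suc i) es)) (r i) (r (Suc i))"
proof -
  have \<sigma>0: "\<sigma>\<^sub>0 \<in> V \<rightarrow>\<^sub>E {..<l}" using init by (simp add: initial_assignment_def)
  have step: "good_step \<epsilon> \<sigma>\<^sub>0 (set (take i es)) (set (take (Suc i) es)) (r i) (r (Suc i))"
    if i: "i < length es" and inv: "invariant \<epsilon> \<sigma>\<^sub>0 (set (take i es)) (r i)" for i
  proof -
    have ins: "set (take (Suc i) es) = insert (es ! i) (set (take i es))"
      using i by (simp add: take_Suc_conv_app_nth)
    have "\<exists>P. feasible V l (real k) (set (take (Suc i) es)) P"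
      using req i by (auto simp: request_sequence_def simp del: take_Suc_Cons)
    then obtain P where P: "perfect (connected_components V (insert (es ! i) (set (take i es)))) P"
      using ins perfect_iff_feasible by metis
    have edges: "e \<subseteq> V" "card e = 2" if "e \<in> set es" for e
      using req that by (auto simp: request_sequence_def)
    have "\<exists>\<tau>. good_step \<epsilon> \<sigma>\<^sub>0 (set (take i es)) (insert (es ! i) (set (take i es))) (r i) \<tau>"
      using ex_good_step[OF \<sigma>0 edges P inv] i by simp
    moreover have "r (Suc i) = (SOME \<tau>. good_step \<epsilon> \<sigma>\<^sub>0 (set (take i es)) (insert (es ! i) (set (take i es))) (r i) \<tau>)"
      using i by (simp add: r_def take_Suc_conv_app_nth)
    ultimately show ?thesis unfolding ins by (metis someI_ex)
  qed
  show inv: "invariant \<epsilon> \<sigma>\<^sub>0 (set (take i es)) (r i)" if "i \<le> length es" for i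
    using that
  proof (induction i)
    case 0
    then show ?case using invariant_initial[OF init \<epsilon>] by (simp add: r_def)
  next
    case (Suc i)
    then show ?case using step[of i] by (simp add: good_step_def)
  qed
  show "good_step \<epsilon> \<sigma>\<^sub>0 (set (take i es)) (set (take (Suc i) es)) (r i) (r (Suc i))" if "i < length es"
    using step[OF that] inv[of i] that by simp
qed

text \<open>Components taken at different times form a laminar family because the edge sets
  increase. So the blocks with at least \<open>1/8\<close> of their vertices displaced by
  \<open>Q\<close> cover at most \<open>8\<close> times as many vertices as \<open>Q\<close>
  displaces.\<close>

lemma card_spoiled_le:
  fixes Q \<sigma>\<^sub>0 :: "'v \<Rightarrow> nat"
  assumes chain: "\<And>i j. i \<in> I \<Longrightarrow> j \<in> I \<Longrightarrow> i \<le> j \<Longrightarrow> E i \<subseteq> E j"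
  defines "D \<equiv> \<Union>{K. \<exists>i\<in>I. K \<in> connected_components V (E (i :: nat)) \<and> card K \<le> 8 * card {v \<in> K. Q v \<noteq> \<sigma>\<^sub>0 v}}"
  shows "D \<subseteq> V" "card D \<le> 8 * moves V \<sigma>\<^sub>0 Q"
proof -
  define F where "F = {K. \<exists>i\<in>I. K \<in> connected_components V (E i) \<and> card K \<le> 8 * card {v \<in> K. Q v \<noteq> \<sigma>\<^sub>0 v}}"
  define X where "X = {v \<in> V. Q v \<noteq> \<sigma>\<^sub>0 v}"
  have FV: "K \<subseteq> V" if "K \<in> F" for K
    using that block_subset[OF partition_on_components] unfolding F_def by blast
  then show "D \<subseteq> V" unfolding D_def F_def[symmetric] by blast
  have "card (\<Union>F) \<le> 8 * card (\<Union>F \<inter> X)"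
  proof (rule card_Union_laminar_le)
    show "finite F" using FV finV by (auto intro: finite_subset[of F "Pow V"])
    show "finite K" if "K \<in> F" for K using FV[OF that] finV by (rule finite_subset)
    show "card K \<le> 8 * card (K \<inter> X)" if "K \<in> F" for K
    proof -
      have "K \<inter> X = {v \<in> K. Q v \<noteq> \<sigma>\<^sub>0 v}" using FV[OF that] by (auto simp: X_def)
      then show ?thesis using that by (auto simp: F_def)
    qed
    fix K K' assume "K \<in> F" "K' \<in> F"
    then obtain i j where ij: "i \<in> I" "j \<in> I" "K \<in> connected_components V (E i)" "K' \<in> connected_components V (E j)"
      by (auto simp: F_def)
    show "K \<subseteq> K' \<or> K' \<subseteq> K \<or> K \<inter> K' = {}"
    proof (cases "i \<le> j")
      case True
      then show ?thesis using components_laminar[OF chain ij(3,4)] ij by blast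
    next
      case False
      then have "E j \<subseteq> E i" using chain[of j i] ij by simp
      then show ?thesis using components_laminar[OF _ ij(4,3)] by blast
    qed
  qed
  also have "\<dots> \<le> 8 * card X" using finV by (intro mult_le_mono2 card_mono) (auto simp: X_def)
  finally show "card D \<le> 8 * moves V \<sigma>\<^sub>0 Q" by (simp add: D_def F_def X_def moves_def)
qed

text \<open>The first phase costs at most \<open>3 * card D * log 2 k\<close>. The rest is charged
  to \<open>card V\<close>: in the last factor, \<open>1\<close> accounts for the phase change,
  \<open>2 * log 2 k\<close> for moved smaller parts and the term with \<open>N\<close> for repairs.
  If the second phase is reached, \<open>k\<close> is less than \<open>8 / \<epsilon>\<close> times
  the distance of \<open>Q\<close>, so \<open>card V\<close> is affordable.\<close>

lemma server_algorithm_cost: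
  assumes init: "initial_assignment V l k \<sigma>\<^sub>0" and req: "request_sequence V l k es" and \<epsilon>: "0 < \<epsilon>"
    and Q: "perfect (connected_components V (set es)) Q"
  defines "r \<equiv> \<lambda>i. server_algorithm \<epsilon> \<sigma>\<^sub>0 (rev (take i es))"
  shows "real (\<Sum>i<length es. moves V (r i) (r (Suc i))) \<le>
    real (moves V \<sigma>\<^sub>0 Q) * (24 * log 2 (real k) + 8 / \<epsilon> * real l * (1 + 2 * log 2 (real k) + 8 * real p ^ 3 * real N))"
proof -
  define E where "E i = set (take i es)" for i
  define C where "C i = connected_components V (E i)" for i
  define D where "D = \<Union>{K. \<exists>i\<in>{..length es}. K \<in> connected_components V (E i) \<and> card K \<le> 8 * card {v \<in> K. Q v \<noteq> \<sigma>\<^sub>0 v}}"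
  define M where "M i = (\<Sum>j<i. moves V (r j) (r (Suc j)))" for i
  define L where "L = log 2 (real k)"
  have "1 \<le> k" using k_pos by simp
  then have L0: "0 \<le> L" by (simp add: L_def)
  have E_mono: "E i \<subseteq> E j" if "i \<le> j" for i j
    unfolding E_def by (rule set_take_subset_set_take[OF that])
  have E_sub: "E i \<subseteq> set es" for i unfolding E_def by (rule set_take_subset)
  have D: "D \<subseteq> V" "card D \<le> 8 * moves V \<sigma>\<^sub>0 Q"
    unfolding D_def using card_spoiled_le[of "{..length es}" E Q \<sigma>\<^sub>0] E_mono by auto
  have part: "partition_on V (C i)" for i unfolding C_def by (rule partition_on_components)
  have QC: "perfect (C i) Q" for i unfolding C_def using perfect_antimono[OF E_sub Q] .
  note lp = log_potential_bounds[OF part QC]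
  have step: "good_step \<epsilon> \<sigma>\<^sub>0 (E i) (E (Suc i)) (r i) (r (Suc i))" if "i < length es" for i
    using server_algorithm_good_step(2)[OF init req _ that, of \<epsilon>] \<epsilon> unfolding E_def r_def by simp
  have pot0: "0 \<le> potential (C i) \<sigma>" for i \<sigma>
    unfolding potential_def using lp(1)[of V i] by simp
  \<comment> \<open>A bound on \<open>potential\<close> in the absence of overload, hence the budget
    of the second phase.\<close>
  define Z where "Z = 2 * real p * (real (card V) * L) + 8 * (real p)\<^sup>2 * real N * ((real p)\<^sup>2 * real (card V))"
  have pot_le: "potential (C i) \<sigma> \<le> Z" if "overload \<sigma> = 0" for i \<sigma>
  proof -
    have "real (weight_potential p k (C i)) \<le> real (p\<^sup>2 * card V)"
      using weight_potential_le[OF part] by (simp only: of_nat_le_iff)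
    then have "8 * (real p)\<^sup>2 * real N * real (weight_potential p k (C i)) \<le> 8 * (real p)\<^sup>2 * real N * ((real p)\<^sup>2 * real (card V))"
      by (intro mult_left_mono) auto
    moreover have "2 * real p * log_potential k V (C i) \<le> 2 * real p * (real (card V) * L)"
      using lp(2)[of V i] by (intro mult_left_mono) (auto simp: L_def)
    ultimately show ?thesis using that by (simp add: potential_def Z_def)
  qed
  \<comment> \<open>After the phase change the right-hand side keeps the first-phase total and the
    at most \<open>card V\<close> moves of the change itself, and adds the budget
    \<open>Z\<close>.\<close>
  have main: "if near \<epsilon> \<sigma>\<^sub>0 (E i)
    then real (M i) + 2 * real (moves V \<sigma>\<^sub>0 (r i)) + 3 * log_potential k D (C i) \<le> 3 * (real (card D) * L)
    else real p * real (M i) + potential (C i) (r i) \<le> real p * (3 * (real (card D) * L) + real (card V)) + Z"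
    if "i \<le> length es" for i
    using that
  proof (induction i)
    case 0
    have "near \<epsilon> \<sigma>\<^sub>0 (E 0)"
      unfolding near_def E_def using initial_perfect[OF init] \<epsilon> by (intro exI[of _ \<sigma>\<^sub>0]) simp
    then show ?case using lp(2)[OF D(1), of 0] by (simp add: M_def r_def L_def)
  next
    case (Suc i)
    have st: "good_step \<epsilon> \<sigma>\<^sub>0 (E i) (E (Suc i)) (r i) (r (Suc i))" using step Suc.prems by simp
    have MS: "real (M (Suc i)) = real (M i) + real (moves V (r i) (r (Suc i)))" by (simp add: M_def)
    show ?case
    proof (cases "near \<epsilon> \<sigma>\<^sub>0 (E (Suc i))")
      case True
      then have near: "near \<epsilon> \<sigma>\<^sub>0 (E i)" using near_antimono[OF E_mono] by (metis le_SucI order_refl)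
      have "K \<subseteq> D" if "K \<in> C i \<union> C (Suc i)" "card K \<le> 8 * card {v \<in> K. Q v \<noteq> \<sigma>\<^sub>0 v}" for K
      proof -
        have "i \<in> {..length es}" "Suc i \<in> {..length es}" using Suc.prems by auto
        then show ?thesis using that unfolding D_def C_def by blast
      qed
      moreover have "blockwise (C (Suc i)) Q" using QC by (simp add: perfect_def)
      ultimately have "real (moves V (r i) (r (Suc i))) + 2 * real (moves V \<sigma>\<^sub>0 (r (Suc i))) + 3 * log_potential k D (C (Suc i))
          \<le> 2 * real (moves V \<sigma>\<^sub>0 (r i)) + 3 * log_potential k D (C i)"
        using st True unfolding good_step_def C_def[symmetric] by blast
      then show ?thesis using Suc near True MS by simp
    next
      case False
      show ?thesis
      proof (cases "near \<epsilon> \<sigma>\<^sub>0 (E i)")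
        case True
        then have "overload (r (Suc i)) = 0" using st False by (simp add: good_step_def)
        then have "potential (C (Suc i)) (r (Suc i)) \<le> Z" by (rule pot_le)
        moreover have "moves V (r i) (r (Suc i)) \<le> card V"
          unfolding moves_def using finV by (intro card_mono) auto
        then have "real (M (Suc i)) \<le> 3 * (real (card D) * L) + real (card V)"
          using Suc True MS lp(1)[OF D(1), of i] by simp
        then have "real p * real (M (Suc i)) \<le> real p * (3 * (real (card D) * L) + real (card V))"
          by (intro mult_left_mono) auto
        ultimately show ?thesis using False by simp
      next
        case far: False
        then have "real p * real (moves V (r i) (r (Suc i))) + potential (C (Suc i)) (r (Suc i)) \<le> potential (C i) (r i)"
          using st unfolding good_step_def C_def by blast
        moreover have "real p * real (M i) + potential (C i) (r i) \<le> real p * (3 * (real (card D) * L) + real (card V)) + Z"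
          using Suc far by simp
        ultimately have "real p * real (M (Suc i)) + potential (C (Suc i)) (r (Suc i)) \<le> real p * (3 * (real (card D) * L) + real (card V)) + Z"
          unfolding MS distrib_left by linarith
        then show ?thesis using False by simp
      qed
    qed
  qed
  define b where "b = real (moves V \<sigma>\<^sub>0 Q)"
  have b0: "0 \<le> b" by (simp add: b_def)
  have "real (card D) \<le> 8 * b" using D(2) unfolding b_def by linarith
  then have DL: "real (card D) * L \<le> 8 * b * L" using L0 by (intro mult_right_mono)
  define R where "R = 1 + 2 * L + 8 * real p ^ 3 * real N"
  have R0: "0 \<le> R" using L0 by (simp add: R_def)
  have "real (M (length es)) \<le> b * (24 * L + 8 / \<epsilon> * real l * R)"
  proof (cases "near \<epsilon> \<sigma>\<^sub>0 (E (length es))")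
    case True
    then have "real (M (length es)) \<le> 24 * b * L"
      using main[of "length es"] lp(1)[OF D(1), of "length es"] DL by simp
    also have "\<dots> \<le> b * (24 * L + 8 / \<epsilon> * real l * R)"
      using b0 R0 \<epsilon> by (simp add: distrib_left)
    finally show ?thesis .
  next
    case False
    moreover have "perfect (connected_components V (E (length es))) Q" using Q by (simp add: E_def)
    \<comment> \<open>Since the last graph is not near, every perfect assignment, in particular
      \<open>Q\<close>, is far from \<open>\<sigma>\<^sub>0\<close>.\<close>
    ultimately have "\<epsilon> * real k < 8 * b" unfolding near_def b_def by (meson not_le)
    then have kb: "real k \<le> 8 / \<epsilon> * b" using \<epsilon> by (simp add: field_simps)
    have "real p * real (M (length es)) \<le> real p * (3 * (real (card D) * L) + real (card V)) + Z"
      using main[of "length es"] False pot0[of "length es" "r (length es)"] by simp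
    also have "\<dots> = real p * (3 * (real (card D) * L) + real (card V) * R)"
      by (simp add: Z_def R_def algebra_simps power2_eq_square power3_eq_cube)
    finally have "real (M (length es)) \<le> 3 * (real (card D) * L) + real (card V) * R"
      using p_pos by simp
    also have "\<dots> \<le> 24 * b * L + real l * (8 / \<epsilon> * b) * R"
    proof -
      have "real (card V) = real l * real k" by (simp add: cardV)
      also have "\<dots> \<le> real l * (8 / \<epsilon> * b)" using kb by (intro mult_left_mono) auto
      finally have "real (card V) * R \<le> real l * (8 / \<epsilon> * b) * R" using R0 by (intro mult_right_mono)
      then show ?thesis using DL by simp
    qed
    also have "\<dots> = b * (24 * L + 8 / \<epsilon> * real l * R)" by (simp add: algebra_simps)
    finally show ?thesis .
  qed
  then show ?thesis by (simp add: M_def b_def L_def R_def)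
qed

section \<open>Comparison with the offline optimum\<close>

lemma moves_le_sum:
  "moves V (\<tau> 0) (\<tau> n) \<le> (\<Sum>i<n. moves V (\<tau> i) (\<tau> (Suc i)))"
proof (induction n)
  case (Suc n)
  then show ?case using moves_triangle[OF finV, of "\<tau> 0" "\<tau> (Suc n)" "\<tau> n"] by simp
qed simp

lemma schedule_cost_moves:
  "schedule_cost V k es \<tau> = real (\<Sum>i<length es. moves V (\<tau> i) (\<tau> (Suc i))) / real k"
  by (simp add: schedule_cost_def moves_def sum_divide_distrib)

text \<open>The last assignment of an optimal schedule is perfect for the final graph, and its
  distance from the start is at most the total number of moves.\<close>

lemma moves_le_opt_cost:
  assumes init: "initial_assignment V l k \<sigma>\<^sub>0" and req: "request_sequence V l k es"
  shows "\<exists>Q. perfect (connected_components V (set es)) Q \<and> real (moves V \<sigma>\<^sub>0 Q) \<le> real k * opt_cost V l k \<sigma>\<^sub>0 es"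
proof -
  obtain \<tau> where \<tau>: "schedule V l (real k) \<sigma>\<^sub>0 es \<tau>" "opt_cost V l k \<sigma>\<^sub>0 es = schedule_cost V k es \<tau>"
    using opt_cost_attained[OF req] by blast
  have "perfect (connected_components V (set es)) (\<tau> (length es))"
  \<comment> \<open>\<open>schedule\<close> demands feasibility only from index \<open>1\<close> on,
    so the initial assignment is treated separately.\<close>
  proof (cases "es = []")
    case True
    then show ?thesis using initial_perfect[OF init] \<tau>(1) by (simp add: schedule_def)
  next
    case False
    then have "length es \<in> {1..length es}" by (simp add: Suc_le_eq)
    then have "feasible V l (real k) (set (take (length es) es)) (\<tau> (length es))"
      using \<tau>(1) unfolding schedule_def by blast
    then show ?thesis by (simp add: perfect_iff_feasible)
  qed
  moreover have "real (moves V (\<tau> 0) (\<tau> (length es))) \<le> real k * opt_cost V l k \<sigma>\<^sub>0 es"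
    using moves_le_sum[of \<tau> "length es"] k_pos by (simp add: \<tau>(2) schedule_cost_moves flip: of_nat_sum)
  ultimately show ?thesis using \<tau>(1) by (auto simp: schedule_def)
qed

lemma online_algorithm_server_algorithm:
  assumes \<epsilon>: "0 < \<epsilon>" and p: "2 \<le> \<epsilon> * real p"
  shows "online_algorithm V l k \<epsilon> (\<lambda>\<sigma>\<^sub>0 es. server_algorithm \<epsilon> \<sigma>\<^sub>0 (rev es))"
  unfolding online_algorithm_def schedule_def run_def
proof (intro allI impI conjI ballI)
  fix \<sigma>\<^sub>0 es i assume a: "initial_assignment V l k \<sigma>\<^sub>0 \<and> request_sequence V l k es" and i: "i \<in> {1..length es}"
  show "feasible V l ((1 + \<epsilon>) * real k) (set (take i es)) (server_algorithm \<epsilon> \<sigma>\<^sub>0 (rev (take i es)))"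
    by (rule invariant_feasible[OF _ server_algorithm_good_step(1) p]) (use a i \<epsilon> in auto)
qed simp

lemma competitive_ratio_server_algorithm:
  assumes \<epsilon>: "0 < \<epsilon>"
  shows "competitive_ratio V l k (\<lambda>\<sigma>\<^sub>0 es. server_algorithm \<epsilon> \<sigma>\<^sub>0 (rev es)) \<le>
    ennreal (24 * log 2 (real k) + 8 / \<epsilon> * real l * (1 + 2 * log 2 (real k) + 8 * real p ^ 3 * real N))"
    (is "_ \<le> ennreal ?c")
  unfolding competitive_ratio_def
proof (rule SUP_least, clarify)
  fix \<sigma>\<^sub>0 es assume init: "initial_assignment V l k \<sigma>\<^sub>0" and req: "request_sequence V l k es"
  let ?A = "\<lambda>\<sigma>\<^sub>0 es. server_algorithm \<epsilon> \<sigma>\<^sub>0 (rev es)"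
  have "1 \<le> k" using k_pos by simp
  then have "0 \<le> log 2 (real k)" by simp
  then have c0: "0 \<le> ?c" using \<epsilon> by (intro add_nonneg_nonneg mult_nonneg_nonneg) auto
  obtain Q where Q: "perfect (connected_components V (set es)) Q"
    "real (moves V \<sigma>\<^sub>0 Q) \<le> real k * opt_cost V l k \<sigma>\<^sub>0 es"
    using moves_le_opt_cost[OF init req] by blast
  then have opt0: "0 \<le> opt_cost V l k \<sigma>\<^sub>0 es"
    using k_pos by (metis of_nat_0_le_iff of_nat_0_less_iff order_trans zero_le_mult_iff not_less)
  have "real k * schedule_cost V k es (run ?A \<sigma>\<^sub>0 es) \<le> real (moves V \<sigma>\<^sub>0 Q) * ?c"
    using server_algorithm_cost[OF init req \<epsilon> Q(1)] k_pos by (simp add: schedule_cost_moves run_def)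
  also have "\<dots> \<le> (real k * opt_cost V l k \<sigma>\<^sub>0 es) * ?c"
    using Q(2) c0 by (intro mult_right_mono)
  finally have "schedule_cost V k es (run ?A \<sigma>\<^sub>0 es) \<le> ?c * opt_cost V l k \<sigma>\<^sub>0 es"
    using k_pos by (simp add: mult.commute mult.left_commute mult.assoc)
  then have le: "ennreal (schedule_cost V k es (run ?A \<sigma>\<^sub>0 es)) \<le> ennreal ?c * ennreal (opt_cost V l k \<sigma>\<^sub>0 es)"
    using c0 opt0 by (simp add: ennreal_leI flip: ennreal_mult)
  show "ennreal (schedule_cost V k es (run ?A \<sigma>\<^sub>0 es)) / ennreal (opt_cost V l k \<sigma>\<^sub>0 es) \<le> ennreal ?c"
  proof (cases "opt_cost V l k \<sigma>\<^sub>0 es = 0")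
    case True
    \<comment> \<open>Here \<open>le\<close> forces the cost of the algorithm to be
      \<open>0\<close>, and \<open>0 / 0 = 0\<close> in \<open>ennreal\<close>.\<close>
    then show ?thesis using le by simp
  next
    case False
    then show ?thesis using le opt0
      by (intro divide_le_posI_ennreal) (auto simp: mult.commute)
  qed
qed

end

theorem theorem5p1:
  fixes \<epsilon> :: real
  assumes "\<epsilon> < 1 / 4"
  shows "\<exists>C>0. \<forall>(l::nat) (k::nat) (V::'v set).
           0 < l \<longrightarrow> 0 < k \<longrightarrow> (10 / real k) powr (1 / 4) \<le> \<epsilon> \<longrightarrow>
           finite V \<longrightarrow> card V = l * k \<longrightarrow>
           (\<exists>A. online_algorithm V l k \<epsilon> A \<and>
                competitive_ratio V l k A \<le> ennreal (C * real l * ln (real k)))"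
proof (cases "0 < \<epsilon>")
  case False
  \<comment> \<open>For \<open>\<epsilon> \<le> 0\<close> the lower bound on
    \<open>\<epsilon>\<close> is unsatisfiable, so any constant serves.\<close>
  have "\<not> (10 / real k) powr (1 / 4) \<le> \<epsilon>" if "0 < k" for k :: nat
  proof -
    have "0 < (10 / real k) powr (1 / 4)" using that by simp
    then show ?thesis using False by linarith
  qed
  then show ?thesis by (intro exI[of _ 1]) auto
next
  case \<epsilon>: True
  \<comment> \<open>This \<open>p\<close> makes the relative excess \<open>2 / p\<close> at most
    \<open>\<epsilon>\<close>. It depends on \<open>\<epsilon>\<close> only and is fixed before
    \<open>l\<close>, \<open>k\<close> and \<open>V\<close>.\<close>
  define p where "p = nat \<lceil>2 / \<epsilon>\<rceil>"
  have "2 / \<epsilon> \<le> real p" unfolding p_def by (rule real_nat_ceiling_ge)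
  then have p: "2 \<le> \<epsilon> * real p" using \<epsilon> by (simp add: field_simps)
  then have p_pos: "0 < p" by (cases p) auto
  obtain N where N: "\<And>(L :: 'v set set) cl g g' l s0. repairable (p\<^sup>2) N L cl g g' l s0"
    using ex_repairable[where 'i = "'v set"] by blast
  \<comment> \<open>With \<open>log 2 k \<le> 2 * ln k\<close> and \<open>1 \<le> ln k\<close>, the
    term \<open>24 * log 2 k\<close> gives \<open>48\<close>, and \<open>1 + 2 * log 2 k\<close>
    gives the \<open>5\<close>.\<close>
  define C where "C = 48 + 8 / \<epsilon> * (5 + 8 * real p ^ 3 * real N)"
  have "C > 0" using \<epsilon> by (simp add: C_def add_pos_nonneg)
  moreover have "\<exists>A. online_algorithm V l k \<epsilon> A \<and> competitive_ratio V l k A \<le> ennreal (C * real l * ln (real k))"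
    if l: "0 < l" and k: "0 < k" and bound: "(10 / real k) powr (1 / 4) \<le> \<epsilon>" and V: "finite V" "card V = l * k"
    for l k and V :: "'v set"
  proof -
    interpret servers V l k p N by unfold_locales (use V k p_pos N in auto)
    \<comment> \<open>The bounds on \<open>\<epsilon>\<close> force \<open>k > 10\<close>, so
      \<open>ln k\<close> is at least \<open>1\<close> and absorbs additive constants.\<close>
    have "10 / real k < 1"
    proof (rule ccontr)
      assume "\<not> 10 / real k < 1"
      then have "1 \<le> (10 / real k) powr (1 / 4)" by (intro ge_one_powr_ge_zero) auto
      then show False using bound assms by simp
    qed
    then have "10 < real k" using k by (simp add: field_simps)
    then have "ln (exp 1) \<le> ln (real k)" using exp_le by (subst ln_le_cancel_iff) auto
    then have ln1: "1 \<le> ln (real k)" by simp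
    have "ln (exp 1) \<le> ln (2 ^ 2 :: real)" using exp_le by (subst ln_le_cancel_iff) auto
    then have ln2: "1 / 2 \<le> ln (2 :: real)" unfolding ln_realpow by simp
    have "log 2 (real k) = ln (real k) / ln 2" by (simp add: log_def)
    also have "\<dots> \<le> ln (real k) / (1 / 2)"
      using ln1 ln2 by (intro divide_left_mono) auto
    finally have lg: "log 2 (real k) \<le> 2 * ln (real k)" by simp
    have "24 * log 2 (real k) \<le> 48 * (1 * ln (real k))" using lg by simp
    also have "\<dots> \<le> 48 * (real l * ln (real k))"
      using l ln1 by (intro mult_left_mono mult_right_mono) auto
    finally have 1: "24 * log 2 (real k) \<le> 48 * (real l * ln (real k))" .
    have "8 * real p ^ 3 * real N * 1 \<le> 8 * real p ^ 3 * real N * ln (real k)"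
      using ln1 by (intro mult_left_mono) auto
    then have "1 + 2 * log 2 (real k) + 8 * real p ^ 3 * real N \<le> (5 + 8 * real p ^ 3 * real N) * ln (real k)"
      using lg ln1 by (simp add: distrib_right)
    then have "8 / \<epsilon> * real l * (1 + 2 * log 2 (real k) + 8 * real p ^ 3 * real N)
        \<le> 8 / \<epsilon> * real l * ((5 + 8 * real p ^ 3 * real N) * ln (real k))"
      using \<epsilon> by (intro mult_left_mono) auto
    with 1 have "24 * log 2 (real k) + 8 / \<epsilon> * real l * (1 + 2 * log 2 (real k) + 8 * real p ^ 3 * real N)
        \<le> C * real l * ln (real k)"
      by (simp add: C_def algebra_simps)
    then have "competitive_ratio V l k (\<lambda>\<sigma>\<^sub>0 es. server_algorithm \<epsilon> \<sigma>\<^sub>0 (rev es)) \<le> ennreal (C * real l * ln (real k))"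
      using competitive_ratio_server_algorithm[OF \<epsilon>] by (meson ennreal_leI order_trans)
    then show ?thesis using online_algorithm_server_algorithm[OF \<epsilon> p] by blast
  qed
  ultimately show ?thesis by blast
qed

end
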